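(* Let $k\ge2$ be an integer and $n=(2k-1)^2-4$. There exists a Euclidean $4$-design $(X,w)$ in $\mathbb R^n$ supported by two concentric spheres, $X=X_1\cup X_2$ with $X_1\subset S^{n-1}(1)$ and $X_2\subset S^{n-1}(r_2)$ for some $r_2>0$, $r_2\ne1$, having the parameters $|X_1|=2(2k+1)(k-1)^3$, $|X_2|=2k^3(2k-3)$, $A(X_1,X_1)=\{\frac{k-2}{k(2k-3)},-\frac1{2k-3}\}$, $A(X_2,X_2)=\{\frac1{2k+1},-\frac{k+1}{(k-1)(2k+1)}\}$, $A(X_1,X_2)=\{\frac1{\sqrt n},-\frac1{\sqrt n}\}$, $w(\boldsymbol x)=1$ for $\boldsymbol x\in X_1$ and $w(\boldsymbol x)=\frac{(2k+1)^2(k-1)^4}{(2k-3)^2k^4}r_2^{-4}$ for $\boldsymbol x\in X_2$, if and only if there exists a tight spherical $4$-design on the unit sphere $S^n\subset\mathbb R^{n+1}$.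
   Context: A weighted finite set $(X,w)$ in $\mathbb R^n$ supported by two concentric spheres: finite $X=X_1\cup X_2$, $X_i\subset S^{n-1}(r_i)$ (sphere of radius $r_i>0$ centred at the origin, $r_1\ne r_2$), $w:X\to\mathbb R_{>0}$. It is a Euclidean $t$-design if $\sum_{i=1}^2\frac{w(X_i)}{|S_i|}\int_{S_i}f\,d\sigma_i=\sum_{\boldsymbol u\in X}w(\boldsymbol u)f(\boldsymbol u)$ for all polynomials $f$ of degree $\le t$, where $S_i=S^{n-1}(r_i)$, $\sigma_i$ surface measure, $|S_i|=\sigma_i(S_i)$, $w(X_i)=\sum_{\boldsymbol x\in X_i}w(\boldsymbol x)$. $A(X_\lambda,X_\mu)=\{\frac{\boldsymbol x\cdot\boldsymbol y}{r_\lambda r_\mu}:\boldsymbol x\in X_\lambda,\boldsymbol y\in X_\mu,\boldsymbol x\ne\boldsymbol y\}$. A spherical $t$-design on $S^n\subset\mathbb R^{n+1}$ is a finite nonempty $Y\subset S^n$ such that $\frac1{|Y|}\sum_{\boldsymbol y\in Y}f(\boldsymbol y)$ equals the average of $f$ over $S^n$ (w.r.t. surface measure) for every polynomial $f$ in $n+1$ variables of degree $\le t$; a spherical $4$-design $Y$ on $S^n$ is tight if $|Y|=\frac{(n+1)(n+4)}{2}$. *)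

theory Defs
  imports "HOL-Analysis.Analysis"
begin

section \<open>Surface measure on a sphere centred at the origin\<close>

text \<open>
  The library has no surface measure.  As usual in polar coordinates, the surface measure of a
  Borel set \<open>A\<close> on the sphere of radius \<open>r > 0\<close> in dimension \<open>d\<close> is \<open>d / r\<close> times the Lebesgue
  measure of the cone \<open>{t *\<^sub>R a | 0 < t < 1, a \<in> A}\<close>, which is the preimage of \<open>A\<close> under the
  radial projection of the punctured ball.
\<close>

definition sphere_measure :: "real \<Rightarrow> 'a::euclidean_space measure" where
  "sphere_measure r =
     scale_measure (ennreal (real DIM('a) / r))
       (distr (restrict_space lborel (ball 0 r - {0})) (restrict_space borel (sphere 0 r))
          (\<lambda>x. (r / norm x) *\<^sub>R x))"

definition sphere_average :: "real \<Rightarrow> ('a::euclidean_space \<Rightarrow> real) \<Rightarrow> real" where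
  "sphere_average r f =
     (1 / measure (sphere_measure r :: 'a measure) (sphere 0 r)) * (LINT x|sphere_measure r. f x)"

lemma space_sphere_measure [simp]: "space (sphere_measure r) = sphere 0 r"
  by (simp add: sphere_measure_def space_restrict_space space_scale_measure)

lemma sets_sphere_measure [simp]:
  "sets (sphere_measure r) = sets (restrict_space borel (sphere 0 r))"
  by (simp add: sphere_measure_def)

lemma radial_projection_measurable:
  fixes r :: real
  assumes "r > 0"
  shows "(\<lambda>x::'a::euclidean_space. (r / norm x) *\<^sub>R x)
           \<in> restrict_space lborel (ball 0 r - {0}) \<rightarrow>\<^sub>M restrict_space borel (sphere 0 r)"
proof (rule measurable_restrict_space2)
  show "(\<lambda>x::'a. (r / norm x) *\<^sub>R x) \<in> space (restrict_space lborel (ball 0 r - {0})) \<rightarrow> sphere 0 r"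
    using assms by (auto simp: space_restrict_space)
  have "(\<lambda>x::'a. (r / norm x) *\<^sub>R x) \<in> borel_measurable borel"
    by measurable
  then show "(\<lambda>x::'a. (r / norm x) *\<^sub>R x) \<in> borel_measurable (restrict_space lborel (ball 0 r - {0}))"
    by (intro measurable_restrict_space1) simp
qed

lemma emeasure_sphere_measure:
  fixes A :: "'a::euclidean_space set"
  assumes "r > 0" "A \<in> sets borel" "A \<subseteq> sphere 0 r"
  shows "emeasure (sphere_measure r) A =
           ennreal (real DIM('a) / r) * emeasure lborel {x \<in> ball 0 r - {0}. (r / norm x) *\<^sub>R x \<in> A}"
proof -
  let ?S = "ball 0 r - {0} :: 'a set"
  have A: "A \<in> sets (restrict_space borel (sphere 0 r))"
    using assms by (auto simp: sets_restrict_space image_iff)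
  have eq: "(\<lambda>x. (r / norm x) *\<^sub>R x) -` A \<inter> space (restrict_space lborel ?S)
             = {x \<in> ?S. (r / norm x) *\<^sub>R x \<in> A}"
    by (auto simp: space_restrict_space)
  show ?thesis
    unfolding sphere_measure_def emeasure_scale_measure
    by (subst emeasure_distr[OF radial_projection_measurable[OF assms(1)] A], subst eq,
        subst emeasure_restrict_space) auto
qed

lemma measure_sphere_measure_sphere:
  assumes "r > 0"
  shows "measure (sphere_measure r) (sphere 0 r :: 'a::euclidean_space set) =
           real DIM('a) / r * measure lborel (ball 0 r :: 'a set)"
proof -
  let ?S = "ball 0 r - {0} :: 'a set"
  have eq: "{x \<in> ?S. (r / norm x) *\<^sub>R x \<in> sphere 0 r} = ?S"
    using assms by auto
  have "emeasure (sphere_measure r) (sphere 0 r :: 'a set)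
          = ennreal (real DIM('a) / r) * emeasure lborel ?S"
    using emeasure_sphere_measure[of r "sphere 0 r :: 'a set"] assms unfolding eq by simp
  also have "emeasure lborel ?S = emeasure lborel (ball 0 r :: 'a set)"
    by (subst emeasure_Diff_null_set) auto
  finally show ?thesis
    using assms by (simp add: measure_def enn2real_mult)
qed

text \<open>The sort \<open>wellorder\<close> on the index type is inherited from \<open>measure_orthogonal_image\<close>.\<close>

lemma sphere_measure_orthogonal_invariant:
  fixes A :: "(real^'n::{finite,wellorder}) set" and T :: "real^'n::{finite,wellorder} \<Rightarrow> real^'n::{finite,wellorder}"
  assumes r: "r > 0" and A: "A \<in> sets borel" "A \<subseteq> sphere 0 r" and T: "orthogonal_transformation T"
  shows "emeasure (sphere_measure r) (T ` A) = emeasure (sphere_measure r) A"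
proof -
  let ?C = "\<lambda>A. {x \<in> ball 0 r - {0}. (r / norm x) *\<^sub>R x \<in> A} :: (real^'n::{finite,wellorder}) set"
  have lin: "linear T" and nrm: "\<And>x. norm (T x) = norm x" and inj: "inj T" and sur: "surj T"
    using T orthogonal_transformation_linear orthogonal_transformation_norm
      orthogonal_transformation_inj orthogonal_transformation_surj by blast+
  have cone_borel: "?C B \<in> sets borel" if "B \<in> sets borel" for B
  proof -
    have "{x \<in> space borel. (r / norm x) *\<^sub>R x \<in> B} \<in> sets (borel :: (real^'n::{finite,wellorder}) measure)"
      using that by measurable
    then have "{x \<in> space borel. (r / norm x) *\<^sub>R x \<in> B} \<inter> (ball 0 r - {0}) \<in> sets borel"
      by (intro sets.Int) auto
    moreover have "{x \<in> space borel. (r / norm x) *\<^sub>R x \<in> B} \<inter> (ball 0 r - {0}) = ?C B"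
      by auto
    ultimately show ?thesis by simp
  qed
  define U where "U = inv T"
  have U: "orthogonal_transformation U"
    using T unfolding U_def by (rule orthogonal_transformation_inv)
  have "bij T"
    using inj sur by (rule bijI)
  then have TA: "T ` A = U -` A \<inter> space borel"
    unfolding U_def by (simp add: bij_vimage_eq_inv_image[OF bij_imp_bij_inv] inv_inv_eq)
  have "U \<in> borel_measurable borel"
    using orthogonal_transformation_linear[OF U]
    by (intro borel_measurable_continuous_onI linear_continuous_on)
      (simp add: linear_conv_bounded_linear)
  then have TAb: "T ` A \<in> sets borel"
    unfolding TA using A(1) by (rule measurable_sets)
  have TAs: "T ` A \<subseteq> sphere 0 r"
    using A(2) nrm by auto
  have img: "?C (T ` A) = T ` ?C A"
  proof (intro set_eqI iffI)
    fix y assume y: "y \<in> ?C (T ` A)"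
    obtain x where x: "y = T x" using sur by blast
    have "T ((r / norm x) *\<^sub>R x) \<in> T ` A"
      using y nrm[of x] linear_cmul[OF lin, of "r / norm x" x] by (simp add: x)
    then have "(r / norm x) *\<^sub>R x \<in> A"
      using inj by (simp add: inj_image_mem_iff)
    moreover have "x \<in> ball 0 r - {0}"
      using y nrm[of x] linear_0[OF lin] unfolding x by auto
    ultimately show "y \<in> T ` ?C A" unfolding x by blast
  next
    fix y assume "y \<in> T ` ?C A"
    then obtain x where y: "y = T x" and x: "x \<in> ?C A" by (rule imageE)
    have "T ((r / norm x) *\<^sub>R x) \<in> T ` A"
      using x by simp
    then have "(r / norm (T x)) *\<^sub>R T x \<in> T ` A"
      by (simp only: nrm linear_cmul[OF lin])
    moreover have "norm (T x) < r" "norm (T x) \<noteq> 0"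
      using x by (simp_all only: nrm) simp_all
    ultimately show "y \<in> ?C (T ` A)"
      unfolding y by (simp only: mem_Collect_eq) auto
  qed
  have "bounded (?C A)"
    by (rule bounded_subset[OF bounded_ball[of 0 r]]) auto
  then have fin: "?C A \<in> lmeasurable"
    using cone_borel[OF A(1)] by (intro bounded_set_imp_lmeasurable) auto
  have "emeasure lborel (?C (T ` A)) = emeasure lebesgue (T ` ?C A)"
    using cone_borel[OF TAb] unfolding img[symmetric] by simp
  also have "\<dots> = emeasure lebesgue (?C A)"
    by (simp only: emeasure_eq_measure2[OF measurable_orthogonal_image[OF T fin]]
        emeasure_eq_measure2[OF fin] measure_orthogonal_image[OF T fin])
  also have "\<dots> = emeasure lborel (?C A)"
    using cone_borel[OF A(1)] by simp
  finally show ?thesis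
    by (simp only: emeasure_sphere_measure[OF r A] emeasure_sphere_measure[OF r TAb TAs])
qed

section \<open>Polynomials of bounded degree\<close>

definition exponents_upto :: "nat \<Rightarrow> ('n::finite \<Rightarrow> nat) set" where
  "exponents_upto t = {e. (\<Sum>i\<in>UNIV. e i) \<le> t}"

lemma finite_exponents_upto: "finite (exponents_upto t :: ('n::finite \<Rightarrow> nat) set)"
proof (rule finite_subset)
  show "(exponents_upto t :: ('n \<Rightarrow> nat) set) \<subseteq> Pi\<^sub>E UNIV (\<lambda>_. {..t})"
    unfolding exponents_upto_def
    by (auto simp: PiE_UNIV_domain) (meson finite member_le_sum le_trans UNIV_I zero_le)
  show "finite (Pi\<^sub>E (UNIV :: 'n set) (\<lambda>_. {..t}))"
    by (intro finite_PiE) auto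
qed

definition polynomial_of_degree_le :: "nat \<Rightarrow> (real^'n \<Rightarrow> real) \<Rightarrow> bool" where
  "polynomial_of_degree_le t f \<longleftrightarrow>
     (\<exists>c :: ('n \<Rightarrow> nat) \<Rightarrow> real.
        f = (\<lambda>x. \<Sum>e\<in>exponents_upto t. c e * (\<Prod>i\<in>UNIV. (x $ i) ^ e i)))"

section \<open>Euclidean and spherical designs\<close>

definition euclidean_design_two_spheres ::
    "nat \<Rightarrow> real \<Rightarrow> real \<Rightarrow> (real^'n) set \<Rightarrow> (real^'n) set \<Rightarrow> (real^'n \<Rightarrow> real) \<Rightarrow> bool" where
  "euclidean_design_two_spheres t r1 r2 X1 X2 w \<longleftrightarrow>
     r1 > 0 \<and> r2 > 0 \<and> r1 \<noteq> r2 \<and>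
     finite (X1 \<union> X2) \<and> X1 \<subseteq> sphere 0 r1 \<and> X2 \<subseteq> sphere 0 r2 \<and>
     (\<forall>x\<in>X1 \<union> X2. w x > 0) \<and>
     (\<forall>f. polynomial_of_degree_le t f \<longrightarrow>
        (\<Sum>x\<in>X1. w x) * sphere_average r1 f + (\<Sum>x\<in>X2. w x) * sphere_average r2 f
          = (\<Sum>u\<in>X1 \<union> X2. w u * f u))"

definition inner_products :: "real \<Rightarrow> real \<Rightarrow> (real^'n) set \<Rightarrow> (real^'n) set \<Rightarrow> real set" where
  "inner_products r s X Y = {(x \<bullet> y) / (r * s) | x y. x \<in> X \<and> y \<in> Y \<and> x \<noteq> y}"

definition spherical_design :: "nat \<Rightarrow> (real^'m) set \<Rightarrow> bool" where
  "spherical_design t Y \<longleftrightarrow>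
     finite Y \<and> Y \<noteq> {} \<and> Y \<subseteq> sphere 0 1 \<and>
     (\<forall>f. polynomial_of_degree_le t f \<longrightarrow>
        (1 / real (card Y)) * (\<Sum>y\<in>Y. f y) = sphere_average 1 f)"

text \<open>On the sphere \<open>S\<^sup>n\<close>, where \<open>n + 1\<close> is the ambient dimension \<open>CARD('m)\<close>, the size
  \<open>(n + 1) (n + 4) / 2\<close> of a tight design becomes \<open>CARD('m) (CARD('m) + 3) / 2\<close>.\<close>

definition tight_spherical_4_design :: "(real^'m) set \<Rightarrow> bool" where
  "tight_spherical_4_design Y \<longleftrightarrow>
     spherical_design 4 Y \<and> real (card Y) = real CARD('m) * (real CARD('m) + 3) / 2"

end

theory Submission
  imports Defs "HOL-Probability.Distributions"
begin

text \<open>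
  A tight spherical 4-design \<open>Y\<close> has only two inner products \<open>\<alpha> > 0 > \<beta>\<close>, the roots of the
  reproducing kernel of the polynomials of degree at most 2.  Cutting \<open>Y\<close> at the two heights
  \<open>\<beta>\<close> and \<open>\<alpha>\<close> over a point \<open>y0\<close> and rescaling the layers to unit spheres gives \<open>X\<^sub>1\<close> and \<open>X\<^sub>2\<close>.
  They are spherical 3-designs because \<open>\<alpha> \<noteq> \<beta>\<close> separates the layers in every moment of degree
  at most 3 (multiply by one more factor \<open>y0 \<bullet> y\<close>), while in degree 4 only the sum of the two
  layers is controlled; the ratio of the fourth powers of the layer radii is the weight.

  Conversely, a Euclidean design as described determines the moments of degree 1 and 2 on each
  sphere, and a single combination in degrees 3 and 4.  As the cross inner products are
  \<open>\<plusminus> 1 / sqrt n\<close>, the cubic moments of \<open>X\<^sub>2\<close> vanish at the points of \<open>X\<^sub>1\<close>; hence so do those of \<open>X\<^sub>1\<close>,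
  whose cubic moment tensor is therefore zero.  So both layers are 3-designs and can be stacked over
  \<open>y0\<close>.
\<close>

section \<open>Averages over spheres\<close>

text \<open>Sums and averages are tested on products of inner products \<open>a \<bullet> x\<close>
  with arbitrary vectors, up to degree 4; this turns both design notions into moment identities that
  behave well under affine maps. The sphere averages of such products are then needed exactly. As
  the index types are only \<open>finite\<close>, they are found without general rotations:
  coordinate reflections kill monomials with an odd exponent, and comparison with the product
  Gaussian gives the even ones up to one constant per degree, which is fixed by summing to a power
  of the norm. In dimension \<open>n + 1\<close> the kernel is proportional to
  \<open>(n + 3) t^2 + 2 t - 1\<close>, with discriminant \<open>4 (n + 4)\<close>. As
  \<open>n + 4 = (2 k - 1)^2\<close>, its roots are rational: \<alpha> = 1 / (2 k) and \<beta> = - 1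
  / (2 (k - 1)). The layer sizes are then forced by counting and by the first moment along
  \<open>y0\<close>. The radius \<open>r2\<close> is free: the factor \<open>r2^-4\<close> in the
  weight cancels the scaling of degree 4, and the lower moments hold on each layer separately, so
  that their scaling is immaterial.\<close>

lemma scale_measure_eq_density: "scale_measure c M = density M (\<lambda>_. c)"
  by (rule measure_eqI) (simp_all add: emeasure_density_const)

text \<open>The factor \<open>DIM('a) / r\<close> occurs in the integral and in the total mass and
  cancels, and the origin is a null set. What remains is the mean over the ball of \<open>f\<close>
  made constant on rays, an ordinary Lebesgue integral.\<close>

lemma sphere_average_eq_ball:
  fixes f :: "'a::euclidean_space \<Rightarrow> real"
  assumes r: "r > 0" and f [measurable]: "f \<in> borel_measurable borel"
  shows "sphere_average r f =
    (LINT x|lborel. indicator (ball 0 r) x * f ((r / norm x) *\<^sub>R x)) / measure lborel (ball 0 r :: 'a set)"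
proof -
  let ?S = "ball 0 r - {0} :: 'a set"
  let ?p = "\<lambda>x::'a. (r / norm x) *\<^sub>R x"
  let ?D = "distr (restrict_space lborel ?S) (restrict_space borel (sphere 0 r)) ?p"
  define c where "c = real DIM('a) / r"
  have c: "c > 0" using r by (simp add: c_def)
  have fs: "f \<in> borel_measurable (restrict_space borel (sphere 0 r))"
    by (rule measurable_restrict_space1) simp
  have "(LINT x|sphere_measure r. f x) = (LINT x|density ?D (\<lambda>_. ennreal c). f x)"
    by (simp add: sphere_measure_def scale_measure_eq_density c_def)
  also have "\<dots> = (LINT x|?D. c *\<^sub>R f x)"
    using c fs by (intro integral_density) auto
  also have "\<dots> = c * (LINT x|?D. f x)"
    by simp
  also have "(LINT x|?D. f x) = (LINT x|restrict_space lborel ?S. f (?p x))"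
    using r fs by (intro integral_distr radial_projection_measurable)
  also have "\<dots> = (LINT x|lborel. indicator ?S x *\<^sub>R f (?p x))"
    by (rule integral_restrict_space) simp
  also have "\<dots> = (LINT x|lborel. indicator (ball 0 r) x * f (?p x))"
    by (rule integral_cong_AE)
      (use AE_lborel_singleton[of "0::'a"] in \<open>auto elim!: eventually_mono simp: indicator_def\<close>)
  finally have "(LINT x|sphere_measure r. f x) = c * (LINT x|lborel. indicator (ball 0 r) x * f (?p x))" .
  then show ?thesis
    using c r by (simp add: sphere_average_def measure_sphere_measure_sphere c_def[symmetric])
qed

lemma measurable_ball_radial_projection:
  fixes f :: "'a::euclidean_space \<Rightarrow> real"
  assumes "f \<in> borel_measurable borel"
  shows "(\<lambda>x. indicator (ball 0 r) x * f ((r / norm x) *\<^sub>R x)) \<in> borel_measurable borel"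
proof -
  have "(\<lambda>x::'a. (r / norm x) *\<^sub>R x) \<in> borel_measurable borel"
    by measurable
  from measurable_compose[OF this assms] show ?thesis
    by (intro borel_measurable_times borel_measurable_indicator) auto
qed

lemma integrable_ball_radial_projection:
  fixes f :: "'a::euclidean_space \<Rightarrow> real"
  assumes f: "continuous_on UNIV f"
  shows "integrable lborel (\<lambda>x. indicator (ball 0 r) x * f ((r / norm x) *\<^sub>R x))"
proof -
  have [measurable]: "f \<in> borel_measurable borel"
    using f by (rule borel_measurable_continuous_onI)
  have "compact (f ` cball 0 \<bar>r\<bar>)"
    using f by (intro compact_continuous_image) (auto intro: continuous_on_subset)
  then obtain B where B: "\<And>x. norm x \<le> \<bar>r\<bar> \<Longrightarrow> \<bar>f x\<bar> \<le> B"
    using compact_imp_bounded[of "f ` cball 0 \<bar>r\<bar>"] by (fastforce simp: bounded_iff)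
  have bound: "\<bar>f ((r / norm x) *\<^sub>R x)\<bar> \<le> B" for x :: 'a
    by (rule B) (auto simp: divide_simps)
  have fin: "emeasure lborel (ball 0 r :: 'a set) < \<infinity>"
    by (rule emeasure_bounded_finite) simp
  have "integrable lborel (\<lambda>x. indicator (ball 0 r) x *\<^sub>R f ((r / norm x) *\<^sub>R x))"
    by (rule integrableI_bounded_set_indicator[where B = B])
      (use bound fin in auto)
  then show ?thesis by simp
qed

lemma measure_ball_pos: "r > 0 \<Longrightarrow> measure lborel (ball 0 r :: 'a::euclidean_space set) > 0"
  using content_ball_pos[of r "0::'a"] by simp

lemma sphere_average_sum:
  fixes f :: "'i \<Rightarrow> 'a::euclidean_space \<Rightarrow> real"
  assumes r: "r > 0" and f: "\<And>i. i \<in> I \<Longrightarrow> continuous_on UNIV (f i)"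
  shows "sphere_average r (\<lambda>x. \<Sum>i\<in>I. c i * f i x) = (\<Sum>i\<in>I. c i * sphere_average r (f i))"
proof -
  have m: "\<And>i. i \<in> I \<Longrightarrow> f i \<in> borel_measurable borel"
    using f by (auto intro: borel_measurable_continuous_onI)
  then have "(\<lambda>x. \<Sum>i\<in>I. c i * f i x) \<in> borel_measurable borel"
    by (intro borel_measurable_sum borel_measurable_times) auto
  then show ?thesis
    using m integrable_ball_radial_projection[OF f]
    by (simp add: sphere_average_eq_ball[OF r] sum_distrib_left sum_divide_distrib mult.left_commute
        cong: sum.cong)
qed

lemma sphere_average_const:
  assumes "r > 0"
  shows "sphere_average r (\<lambda>_::'a::euclidean_space. c) = c"
  using measure_ball_pos[OF assms, where 'a = 'a] by (simp add: sphere_average_eq_ball[OF assms])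

lemma sphere_average_cong:
  fixes f g :: "'a::euclidean_space \<Rightarrow> real"
  assumes "\<And>x. norm x = r \<Longrightarrow> f x = g x"
  shows "sphere_average r f = sphere_average r g"
  unfolding sphere_average_def
  by (intro arg_cong2[of _ _ _ _ "(*)"] refl Bochner_Integration.integral_cong) (simp_all add: assms)

text \<open>Reflecting the coordinate \<open>b\<close> preserves \<open>lborel\<close> and the norm
  and commutes with the radial projection, so the ball integral equals its own negative.\<close>

lemma sphere_average_reflect:
  fixes f :: "'a::euclidean_space \<Rightarrow> real"
  assumes r: "r > 0" and b: "b \<in> Basis" and f: "continuous_on UNIV f"
    and odd: "\<And>x. f (x - (2 * (x \<bullet> b)) *\<^sub>R b) = - f x"
  shows "sphere_average r f = 0"
proof -
  have [measurable]: "f \<in> borel_measurable borel"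
    using f by (rule borel_measurable_continuous_onI)
  let ?c = "\<lambda>j. if j = b then - 1 else 1 :: real"
  \<comment> \<open>A diagonal map with entries 1 and -1, written with the summand 0 to fit
    \<open>lborel_affine_euclidean\<close>; its Jacobian factor is 1.\<close>
  define T where "T x = (0::'a) + (\<Sum>j\<in>Basis. (?c j * (x \<bullet> j)) *\<^sub>R j)" for x
  have T: "T x = x - (2 * (x \<bullet> b)) *\<^sub>R b" for x
  proof -
    have "T x = (\<Sum>j\<in>Basis. (x \<bullet> j) *\<^sub>R j - (if j = b then (2 * (x \<bullet> j)) *\<^sub>R j else 0))"
      unfolding T_def by (auto intro!: sum.cong simp: scaleR_left_diff_distrib[symmetric])
    also have "\<dots> = x - (2 * (x \<bullet> b)) *\<^sub>R b"
      using b by (simp add: sum_subtractf euclidean_representation)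
    finally show ?thesis .
  qed
  have nT: "norm (T x) = norm x" for x
  proof -
    have "T x \<bullet> T x = x \<bullet> x"
      using b by (simp add: T algebra_simps inner_commute)
    then show ?thesis by (simp add: norm_eq_sqrt_inner)
  qed
  have Tm [measurable]: "T \<in> borel_measurable borel"
    unfolding T_def by measurable
  have scale: "T (t *\<^sub>R x) = t *\<^sub>R T x" for t x
    by (simp add: T algebra_simps)
  have oddT: "f (T x) = - f x" for x
    by (simp add: T odd)
  have "lborel = density (distr lborel borel T) (\<lambda>_. (\<Prod>j\<in>Basis. \<bar>?c j\<bar>))"
    unfolding T_def by (rule lborel_affine_euclidean) auto
  also have "(\<Prod>j\<in>Basis. \<bar>?c j\<bar>) = 1"
    by (rule prod.neutral) auto
  finally have lb: "distr lborel borel T = lborel"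
    by (simp add: density_1)
  let ?g = "\<lambda>x. indicator (ball 0 r) x * f ((r / norm x) *\<^sub>R x)"
  have "(LINT x|lborel. ?g x) = (LINT x|distr lborel borel T. ?g x)"
    by (simp add: lb)
  also have "\<dots> = (LINT x|lborel. ?g (T x))"
    by (rule integral_distr)
      (use measurable_ball_radial_projection[of f r] in simp_all)
  also have "\<dots> = (LINT x|lborel. - ?g x)"
    by (intro Bochner_Integration.integral_cong refl)
      (simp add: nT scale[symmetric] oddT indicator_def)
  also have "\<dots> = - (LINT x|lborel. ?g x)" by simp
  finally show ?thesis by (simp add: sphere_average_eq_ball[OF r])
qed

section \<open>Even moments of the sphere by comparison with the Gaussian\<close>

lemma nn_integral_ball_scale:
  fixes g :: "'a::euclidean_space \<Rightarrow> ennreal"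
  assumes [measurable]: "g \<in> borel_measurable borel" and g: "\<And>c x. c > 0 \<Longrightarrow> g (c *\<^sub>R x) = g x"
    and r: "r > 0"
  shows "(\<integral>\<^sup>+x\<in>ball 0 r. g x \<partial>lborel) = ennreal (r ^ DIM('a)) * (\<integral>\<^sup>+x\<in>ball 0 1. g x \<partial>lborel)"
proof -
  have [measurable]: "ball (0::'a) r \<in> sets borel" "ball (0::'a) 1 \<in> sets borel" by simp_all
  have eq: "indicator (ball 0 r) (r *\<^sub>R x) = (indicator (ball 0 1) x :: ennreal)" for x :: 'a
    using r by (auto simp: indicator_def)
  have "(\<integral>\<^sup>+x\<in>ball 0 r. g x \<partial>lborel) = (\<integral>\<^sup>+x. g x * indicator (ball 0 r) x
      \<partial>density (distr lborel borel (\<lambda>x. 0 + r *\<^sub>R x)) (\<lambda>_. \<bar>r ^ DIM('a)\<bar>))"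
    using r by (subst lborel_affine[of r 0]) auto
  also have "\<dots> = (\<integral>\<^sup>+x. ennreal (r ^ DIM('a)) * (g (r *\<^sub>R x) * indicator (ball 0 r) (r *\<^sub>R x)) \<partial>lborel)"
    using r by (subst nn_integral_density) (auto simp: nn_integral_distr)
  also have "\<dots> = ennreal (r ^ DIM('a)) * (\<integral>\<^sup>+x\<in>ball 0 1. g x \<partial>lborel)"
    using r by (simp add: g eq nn_integral_cmult)
  finally show ?thesis .
qed

text \<open>For a nonnegative function \<open>g\<close> that is constant on rays, the image of \<open>g dx\<close> under the norm
  gives the interval \<open>{..<r}\<close> mass proportional to \<open>r ^ n\<close>, so it depends on \<open>g\<close> only up to a factor.\<close>

lemma nn_integral_radial:
  fixes g :: "'a::euclidean_space \<Rightarrow> ennreal" and h :: "real \<Rightarrow> ennreal"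
  assumes [measurable]: "g \<in> borel_measurable borel" and g: "\<And>c x. c > 0 \<Longrightarrow> g (c *\<^sub>R x) = g x"
    and fin: "(\<integral>\<^sup>+x\<in>ball 0 1. g x \<partial>lborel) < \<infinity>"
    and [measurable]: "h \<in> borel_measurable borel"
  shows "(\<integral>\<^sup>+x. g x * h (norm x) \<partial>lborel) * emeasure lborel (ball 0 1 :: 'a set)
       = (\<integral>\<^sup>+x\<in>ball 0 1. g x \<partial>lborel) * (\<integral>\<^sup>+x. h (norm (x::'a)) \<partial>lborel)"
proof -
  define c where "c = (\<integral>\<^sup>+x\<in>ball 0 1. g x \<partial>lborel)"
  define v where "v = emeasure lborel (ball 0 1 :: 'a set)"
  have v: "v < \<infinity>"
    unfolding v_def by (rule emeasure_bounded_finite) simp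
  \<comment> \<open>Each distribution of the norm is scaled by the unit-ball mass of the other, so
    that the two agree without any division in \<open>ennreal\<close>.\<close>
  define M where "M = scale_measure v (distr (density lborel g) borel norm)"
  define N where "N = scale_measure c (distr (lborel :: 'a measure) borel norm)"
  have M: "emeasure M {..<r} = (if r > 0 then ennreal (r ^ DIM('a)) * c * v else 0)" for r
  proof -
    have "norm -` {..<r} = (ball 0 r :: 'a set)" by auto
    then have "emeasure M {..<r} = v * (\<integral>\<^sup>+x\<in>ball 0 r. g x \<partial>lborel)"
      unfolding M_def by (simp add: emeasure_distr emeasure_density)
    then show ?thesis
      using nn_integral_ball_scale[OF assms(1) g, of r] by (auto simp: c_def mult_ac ball_empty not_less)
  qed
  have N: "emeasure N {..<r} = (if r > 0 then ennreal (r ^ DIM('a)) * c * v else 0)" for r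
  proof -
    have "emeasure N {..<r} = c * emeasure lborel (norm -` {..<r} :: 'a set)"
      unfolding N_def by (simp add: emeasure_distr)
    also have "norm -` {..<r} = (ball 0 r :: 'a set)" by auto
    finally show ?thesis
      using nn_integral_ball_scale[of "\<lambda>_::'a. 1" r] by (auto simp: v_def mult_ac ball_empty not_less)
  qed
  have "M = N"
  proof (rule measure_eqI_generator_eq[where E = "range lessThan" and \<Omega> = UNIV
        and A = "\<lambda>i. {..<real i}"])
    show "Int_stable (range lessThan :: real set set)"
    proof (rule Int_stableI_image)
      show "\<exists>k\<in>UNIV. {..<i} \<inter> {..<j} = {..<k}" for i j :: real
        by (rule bexI[of _ "min i j"]) auto
    qed
    show "emeasure M X = emeasure N X" if "X \<in> range lessThan" for X
      using that M N by auto
    show "sets M = sigma_sets UNIV (range lessThan)" "sets N = sigma_sets UNIV (range lessThan)"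
      by (simp_all add: M_def N_def borel_Iio)
    show "(\<Union>i. {..<real i}) = UNIV"
      using reals_Archimedean2 by auto
    show "emeasure M {..<real i} \<noteq> \<infinity>" for i
      using fin v by (auto simp: M c_def[symmetric] ennreal_mult_eq_top_iff)
  qed auto
  have "(\<integral>\<^sup>+x. g x * h (norm x) \<partial>lborel) * v = (\<integral>\<^sup>+t. h t \<partial>M)"
    unfolding M_def by (simp add: nn_integral_scale_measure nn_integral_distr nn_integral_density mult.commute)
  also have "\<dots> = c * (\<integral>\<^sup>+x. h (norm (x::'a)) \<partial>lborel)"
    unfolding \<open>M = N\<close> N_def by (simp add: nn_integral_scale_measure nn_integral_distr)
  finally show ?thesis by (simp add: c_def v_def)
qed

text \<open>The Gaussian is a product over coordinates, which lets moments factor, and also radial,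
  which lets it be compared with the sphere.\<close>

lemma prod_std_normal_density:
  fixes x :: "'a::euclidean_space"
  shows "(\<Prod>b\<in>Basis. std_normal_density (x \<bullet> b)) = (1 / sqrt (2 * pi)) ^ DIM('a) * exp (- (norm x)\<^sup>2 / 2)"
proof -
  have "(\<Prod>b\<in>Basis. exp (- (x \<bullet> b)\<^sup>2 / 2)) = exp (\<Sum>b\<in>Basis. - (x \<bullet> b)\<^sup>2 / 2)"
    by (simp add: exp_sum)
  also have "(\<Sum>b\<in>Basis. - (x \<bullet> b)\<^sup>2 / 2) = - (norm x)\<^sup>2 / 2"
    unfolding power2_norm_eq_inner euclidean_inner[of x x]
    by (simp add: sum_negf sum_divide_distrib power2_eq_square)
  finally show ?thesis
    by (simp add: std_normal_density_def prod_dividef power_one_over)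
qed

text \<open>Fubini over \<open>Basis\<close>; each factor \<open>(2 e)! / (2^e e!)\<close> is the
  double factorial \<open>(2 e - 1)!!\<close>, a moment of the standard normal law.\<close>

lemma nn_integral_gaussian_even_monomial:
  fixes e :: "'a::euclidean_space \<Rightarrow> nat"
  shows "(\<integral>\<^sup>+x. ennreal ((\<Prod>b\<in>Basis. (x \<bullet> b) ^ (2 * e b)) * (\<Prod>b\<in>Basis. std_normal_density (x \<bullet> b))) \<partial>lborel)
    = ennreal (\<Prod>b\<in>Basis. fact (2 * e b) / (2 ^ e b * fact (e b)))"
proof -
  have 1: "(\<integral>\<^sup>+t. ennreal (std_normal_density t * t ^ (2 * k)) \<partial>lborel) = ennreal (fact (2 * k) / (2 ^ k * fact k))" for k
    using std_normal_moment_even[of k]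
    by (subst nn_integral_eq_integral) (auto simp: has_bochner_integral_iff)
  have "(\<integral>\<^sup>+x. ennreal ((\<Prod>b\<in>Basis. (x \<bullet> b) ^ (2 * e b)) * (\<Prod>b\<in>Basis. std_normal_density (x \<bullet> b))) \<partial>lborel)
     = (\<integral>\<^sup>+x. (\<Prod>b\<in>Basis. ennreal (std_normal_density (x \<bullet> b) * (x \<bullet> b) ^ (2 * e b))) \<partial>(lborel::'a measure))"
    by (subst prod_ennreal) (simp_all add: prod.distrib mult.commute zero_le_even_power)
  also have "\<dots> = (\<Prod>b\<in>Basis. \<integral>\<^sup>+t. ennreal (std_normal_density t * t ^ (2 * e b)) \<partial>lborel)"
    by (subst nn_integral_lborel_prod[where f = "\<lambda>b t. ennreal (std_normal_density t * t ^ (2 * e b))"]) auto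
  also have "\<dots> = ennreal (\<Prod>b\<in>Basis. fact (2 * e b) / (2 ^ e b * fact (e b)))"
    by (simp add: 1 prod_ennreal)
  finally show ?thesis .
qed

text \<open>A homogeneous \<open>f\<close> is its value on the sphere times a power of the norm, so
  \<open>nn_integral_radial\<close> separates direction from radius. \<open>K\<close> depends on
  \<open>d\<close> and \<open>r\<close> but not on \<open>f\<close>; its value is left open.\<close>

lemma sphere_average_gaussian:
  assumes r: "r > 0"
  obtains K where "\<And>f :: 'a::euclidean_space \<Rightarrow> real.
     continuous_on UNIV f \<Longrightarrow> (\<And>x. 0 \<le> f x) \<Longrightarrow> (\<And>t x. t > 0 \<Longrightarrow> f (t *\<^sub>R x) = t ^ d * f x) \<Longrightarrow>
     (\<integral>\<^sup>+x. ennreal (f x * (\<Prod>b\<in>Basis. std_normal_density (x \<bullet> b))) \<partial>lborel)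
       = K * ennreal (sphere_average r f)"
proof -
  define V where "V = emeasure lborel (ball 0 1 :: 'a set)"
  \<comment> \<open>The division by \<open>r ^ d\<close> compensates that \<open>g\<close> below
    evaluates \<open>f\<close> at radius \<open>r\<close> instead of 1.\<close>
  define h where "h t = t ^ d * ((1 / sqrt (2 * pi)) ^ DIM('a) * exp (- t\<^sup>2 / 2)) / r ^ d" for t :: real
  have hm [measurable]: "h \<in> borel_measurable borel"
    unfolding h_def by measurable
  have V: "0 < V"
    unfolding V_def using measure_ball_pos[of 1, where 'a = 'a]
    by (auto simp: measure_def zero_less_iff_neq_zero)
  have V': "V < \<infinity>"
    unfolding V_def by (rule emeasure_bounded_finite) simp
  define H where "H = (\<integral>\<^sup>+x. ennreal (h (norm (x::'a))) \<partial>lborel)"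
  show thesis
  proof (rule that[of H])
    fix f :: "'a \<Rightarrow> real"
    assume f: "continuous_on UNIV f" and nn: "\<And>x. 0 \<le> f x"
      and hom: "\<And>t x. t > 0 \<Longrightarrow> f (t *\<^sub>R x) = t ^ d * f x"
    have [measurable]: "f \<in> borel_measurable borel"
      using f by (rule borel_measurable_continuous_onI)
    define g where "g x = f ((r / norm x) *\<^sub>R x)" for x
    have gm [measurable]: "g \<in> borel_measurable borel"
      unfolding g_def by measurable
    have gs: "g (c *\<^sub>R x) = g x" if "c > 0" for c x
      using that by (simp add: g_def)
    have g_nn: "0 \<le> g x" for x
      by (simp add: g_def nn)
    have fg: "f x * (\<Prod>b\<in>Basis. std_normal_density (x \<bullet> b)) = g x * h (norm x)" if "x \<noteq> 0" for x
      using that r by (simp add: g_def h_def hom prod_std_normal_density power_divide)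
    define c where "c = (\<integral>\<^sup>+x\<in>ball 0 1. ennreal (g x) \<partial>lborel)"
    have int: "integrable lborel (\<lambda>x. indicator (ball 0 r) x * g x)"
      unfolding g_def by (rule integrable_ball_radial_projection[OF f])
    have vol: "emeasure lborel (ball 0 r :: 'a set) = ennreal (r ^ DIM('a)) * V"
      using nn_integral_ball_scale[of "\<lambda>_::'a. 1" r] r by (simp add: V_def)
    have "ennreal (LINT x|lborel. indicator (ball 0 r) x * g x)
        = (\<integral>\<^sup>+x. ennreal (indicator (ball 0 r) x * g x) \<partial>lborel)"
      using int by (subst nn_integral_eq_integral) (auto simp: g_nn)
    also have "\<dots> = (\<integral>\<^sup>+x\<in>ball 0 r. ennreal (g x) \<partial>lborel)"
      by (intro nn_integral_cong) (auto simp: indicator_def)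
    also have "\<dots> = ennreal (r ^ DIM('a)) * c"
      unfolding c_def by (rule nn_integral_ball_scale) (use r gs in auto)
    finally have I: "ennreal (LINT x|lborel. indicator (ball 0 r) x * g x) = ennreal (r ^ DIM('a)) * c" .
    \<comment> \<open>Finiteness, required by \<open>nn_integral_radial\<close>, is read off
      \<open>I\<close>, whose left side is the \<open>ennreal\<close> of a real number.\<close>
    have cfin: "c < \<infinity>"
    proof (rule ccontr)
      assume "\<not> c < \<infinity>"
      then have "c = top" by (simp add: not_less top_unique)
      then show False using I r by (simp add: ennreal_mult_top)
    qed
    have avg: "sphere_average r f * measure lborel (ball 0 r :: 'a set)
        = (LINT x|lborel. indicator (ball 0 r) x * g x)"
      using measure_ball_pos[OF r, where 'a = 'a]
      by (simp add: sphere_average_eq_ball[OF r] g_def)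
    have avg_nn: "0 \<le> sphere_average r f"
      by (simp add: sphere_average_eq_ball[OF r] nn)
    have "emeasure lborel (ball 0 r :: 'a set) \<noteq> top"
      using emeasure_bounded_finite[OF bounded_ball, of "0::'a" r] by simp
    then have "ennreal (sphere_average r f) * emeasure lborel (ball 0 r :: 'a set)
       = ennreal (sphere_average r f * measure lborel (ball 0 r :: 'a set))"
      by (simp add: ennreal_mult avg_nn emeasure_eq_ennreal_measure)
    also have "\<dots> = ennreal (r ^ DIM('a)) * c"
      by (simp add: avg I)
    finally have "ennreal (r ^ DIM('a)) * (ennreal (sphere_average r f) * V) = ennreal (r ^ DIM('a)) * c"
      by (simp add: vol mult_ac)
    then have cV: "ennreal (sphere_average r f) * V = c"
      using r by (simp add: ennreal_mult_cancel_left)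
    have "(\<integral>\<^sup>+x. ennreal (f x * (\<Prod>b\<in>Basis. std_normal_density (x \<bullet> b))) \<partial>lborel)
        = (\<integral>\<^sup>+x. ennreal (g x) * ennreal (h (norm x)) \<partial>lborel)"
      by (rule nn_integral_cong_AE)
        (use AE_lborel_singleton[of "0::'a"] in \<open>auto elim!: eventually_mono simp: fg ennreal_mult' g_nn\<close>)
    moreover have "(\<integral>\<^sup>+x. ennreal (g x) * ennreal (h (norm x)) \<partial>lborel) * V = c * H"
      unfolding V_def c_def H_def
      by (rule nn_integral_radial) (use gs cfin in \<open>auto simp: c_def\<close>)
    ultimately have "V * (\<integral>\<^sup>+x. ennreal (f x * (\<Prod>b\<in>Basis. std_normal_density (x \<bullet> b))) \<partial>lborel)
        = V * (H * ennreal (sphere_average r f))"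
      unfolding cV[symmetric] by (simp add: mult_ac)
    then show "(\<integral>\<^sup>+x. ennreal (f x * (\<Prod>b\<in>Basis. std_normal_density (x \<bullet> b))) \<partial>lborel)
        = H * ennreal (sphere_average r f)"
      using V V' by (auto simp: ennreal_mult_cancel_left)
  qed
qed

text \<open>\<kappa> is the inverse of the Gaussian constant, which is neither 0 nor infinite
  because even Gaussian moments are positive and finite. The monomials have degree
  \<open>2 * d\<close>, and all of them share \<kappa>.\<close>

lemma sphere_average_even_monomial:
  assumes r: "r > 0"
  obtains \<kappa> where "\<kappa> > 0"
    "\<And>e. (\<Sum>b\<in>Basis. e b) = d \<Longrightarrow> sphere_average r (\<lambda>x::'a::euclidean_space. \<Prod>b\<in>Basis. (x \<bullet> b) ^ (2 * e b))
       = \<kappa> * (\<Prod>b\<in>Basis. fact (2 * e b) / (2 ^ e b * fact (e b)))"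
proof -
  let ?f = "\<lambda>(e :: 'a \<Rightarrow> nat) (x::'a). \<Prod>b\<in>Basis. (x \<bullet> b) ^ (2 * e b)"
  let ?m = "\<lambda>e :: 'a \<Rightarrow> nat. \<Prod>b\<in>Basis. fact (2 * e b) / (2 ^ e b * fact (e b)) :: real"
  obtain K where K: "\<And>f :: 'a \<Rightarrow> real. continuous_on UNIV f \<Longrightarrow> (\<And>x. 0 \<le> f x) \<Longrightarrow>
      (\<And>t x. t > 0 \<Longrightarrow> f (t *\<^sub>R x) = t ^ (2 * d) * f x) \<Longrightarrow>
     (\<integral>\<^sup>+x. ennreal (f x * (\<Prod>b\<in>Basis. std_normal_density (x \<bullet> b))) \<partial>lborel) = K * ennreal (sphere_average r f)"
    using sphere_average_gaussian[OF r] by blast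
  have m_pos: "?m e > 0" for e
    by (intro prod_pos) auto
  have main: "ennreal (?m e) = K * ennreal (sphere_average r (?f e))" if e: "(\<Sum>b\<in>Basis. e b) = d" for e
  proof -
    have hom: "?f e (t *\<^sub>R x) = t ^ (2 * d) * ?f e x" for t x
      by (simp add: power_mult_distrib prod.distrib power_sum[symmetric] e[symmetric] sum_distrib_left)
    show ?thesis
      unfolding nn_integral_gaussian_even_monomial[symmetric]
      by (rule K[OF _ _ hom]) (auto intro!: continuous_intros prod_nonneg zero_le_even_power)
  qed
  obtain b0 :: 'a where b0: "b0 \<in> Basis" using nonempty_Basis by blast
  let ?e0 = "\<lambda>b. if b = b0 then d else 0"
  have e0: "(\<Sum>b\<in>Basis. ?e0 b) = d" using b0 by simp
  have "K \<noteq> 0" using main[OF e0] m_pos[of ?e0] by auto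
  moreover have "K \<noteq> top"
    using main[OF e0] m_pos[of ?e0] by (auto simp: ennreal_top_mult split: if_splits)
  ultimately obtain k where k: "K = ennreal k" "k > 0"
    by (cases K) (auto simp: less_le)
  have "sphere_average r (?f e) = 1 / k * ?m e" if e: "(\<Sum>b\<in>Basis. e b) = d" for e
  proof -
    \<comment> \<open>\<open>ennreal\<close> sends negative reals to 0, so the sign has to be
      settled before passing back to \<open>real\<close>.\<close>
    have nn: "0 \<le> sphere_average r (?f e)"
    proof (rule ccontr)
      assume "\<not> 0 \<le> sphere_average r (?f e)"
      then have "ennreal (sphere_average r (?f e)) = 0" by (simp add: ennreal_neg)
      then have "ennreal (?m e) = 0" by (simp only: main[OF e] mult_zero_right)
      then show False using m_pos[of e] by (simp only: ennreal_eq_0_iff)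
    qed
    have "ennreal (?m e) = ennreal (k * sphere_average r (?f e))"
      using main[OF e] k by (simp add: ennreal_mult')
    then have "?m e = k * sphere_average r (?f e)"
      using k nn m_pos[of e] by (subst (asm) ennreal_inj) auto
    then show ?thesis using k by simp
  qed
  then show thesis using that[of "1 / k"] k by simp
qed

section \<open>Averages of products of at most four linear forms\<close>

lemma inner_reflect:
  "b \<in> Basis \<Longrightarrow> c \<in> Basis \<Longrightarrow> c \<noteq> b \<Longrightarrow> c \<bullet> (x - (2 * (x \<bullet> b)) *\<^sub>R b) = c \<bullet> x"
  by (simp add: inner_diff_right inner_Basis)

lemma inner_reflect_same: "b \<in> Basis \<Longrightarrow> b \<bullet> (x - (2 * (x \<bullet> b)) *\<^sub>R b) = - (b \<bullet> x)"
  by (simp add: inner_diff_right inner_commute)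

lemma sphere_average_inner_basis:
  fixes b :: "'a::euclidean_space"
  assumes r: "r > 0" and b: "b \<in> Basis" and f: "continuous_on UNIV f"
    and even: "\<And>x. f (x - (2 * (x \<bullet> b)) *\<^sub>R b) = f x"
  shows "sphere_average r (\<lambda>x. (b \<bullet> x) * f x) = 0"
  using r b
proof (rule sphere_average_reflect)
  show "continuous_on UNIV (\<lambda>x. b \<bullet> x * f x)"
    by (intro continuous_intros f)
  show "b \<bullet> (x - (2 * (x \<bullet> b)) *\<^sub>R b) * f (x - (2 * (x \<bullet> b)) *\<^sub>R b) = - (b \<bullet> x * f x)" for x
    unfolding even inner_reflect_same[OF b] by simp
qed

text \<open>Extends a formula from basis vectors to an arbitrary first factor. The continuous
  \<open>f\<close> carries the other factors along, so that products of several forms are freed one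
  factor at a time, the next one being permuted to the front.\<close>

lemma sphere_average_inner_linear:
  fixes a v :: "'a::euclidean_space"
  assumes r: "r > 0" and f: "continuous_on UNIV f"
    and basis: "\<And>b. b \<in> Basis \<Longrightarrow> sphere_average r (\<lambda>x. (b \<bullet> x) * f x) = b \<bullet> v"
  shows "sphere_average r (\<lambda>x. (a \<bullet> x) * f x) = a \<bullet> v"
proof -
  have "sphere_average r (\<lambda>x. (a \<bullet> x) * f x) = sphere_average r (\<lambda>x. \<Sum>b\<in>Basis. (a \<bullet> b) * ((b \<bullet> x) * f x))"
  proof (intro arg_cong[where f = "sphere_average r"] ext)
    show "(a \<bullet> x) * f x = (\<Sum>b\<in>Basis. (a \<bullet> b) * ((b \<bullet> x) * f x))" for x
      by (subst euclidean_inner[of a x]) (simp add: sum_distrib_right mult.assoc inner_commute)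
  qed
  also have "\<dots> = (\<Sum>b\<in>Basis. (a \<bullet> b) * (b \<bullet> v))"
    by (subst sphere_average_sum[OF r]) (auto intro!: continuous_intros f simp: basis)
  also have "\<dots> = a \<bullet> v"
    by (simp add: euclidean_inner[of a v] inner_commute)
  finally show ?thesis .
qed

lemma sphere_average_inner1:
  fixes a :: "'a::euclidean_space"
  assumes r: "r > 0"
  shows "sphere_average r (\<lambda>x. a \<bullet> x) = 0"
proof -
  have "sphere_average r (\<lambda>x. (a \<bullet> x) * 1) = a \<bullet> 0"
    by (rule sphere_average_inner_linear[OF r])
      (auto intro!: continuous_intros simp del: mult_1_right simp: sphere_average_inner_basis[OF r])
  then show ?thesis by simp
qed

text \<open>Distinct basis vectors give 0 by reflection; the common value \<open>k\<close> of the
  squares comes from the trace, as the squares sum to \<open>r\<^sup>2\<close> on the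
  sphere.\<close>

lemma sphere_average_inner2:
  fixes a b :: "'a::euclidean_space"
  assumes r: "r > 0"
  shows "sphere_average r (\<lambda>x. (a \<bullet> x) * (b \<bullet> x)) = r\<^sup>2 / real DIM('a) * (a \<bullet> b)"
proof -
  obtain k where k: "\<And>e. (\<Sum>b\<in>Basis. e b) = 1 \<Longrightarrow> sphere_average r (\<lambda>x::'a. \<Prod>b\<in>Basis. (x \<bullet> b) ^ (2 * e b))
       = k * (\<Prod>b\<in>Basis. fact (2 * e b) / (2 ^ e b * fact (e b)))"
    using sphere_average_even_monomial[OF r, of 1] by blast
  have sq: "sphere_average r (\<lambda>x::'a. (i \<bullet> x) * (i \<bullet> x)) = k" if i: "i \<in> Basis" for i
  proof -
    let ?e = "\<lambda>b. if b = i then 1 else 0 :: nat"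
    have "(\<Prod>b\<in>Basis. (x \<bullet> b) ^ (2 * ?e b)) = (i \<bullet> x) * (i \<bullet> x)" for x :: 'a
    proof -
      have "(\<Prod>b\<in>Basis. (x \<bullet> b) ^ (2 * ?e b)) = (\<Prod>b\<in>Basis. if b = i then (x \<bullet> b)\<^sup>2 else 1)"
        by (intro prod.cong) auto
      then show ?thesis using i by (simp add: power2_eq_square inner_commute)
    qed
    moreover have "(\<Prod>b\<in>Basis. fact (2 * ?e b) / (2 ^ ?e b * fact (?e b))) = (1::real)"
      by (intro prod.neutral) auto
    ultimately show ?thesis using k[of ?e] i by simp
  qed
  have "r\<^sup>2 = sphere_average r (\<lambda>x::'a. \<Sum>i\<in>Basis. 1 * ((i \<bullet> x) * (i \<bullet> x)))"
  proof -
    have "sphere_average r (\<lambda>x::'a. \<Sum>i\<in>Basis. 1 * ((i \<bullet> x) * (i \<bullet> x))) = sphere_average r (\<lambda>_::'a. r\<^sup>2)"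
    proof (rule sphere_average_cong)
      fix x :: 'a assume "norm x = r"
      then show "(\<Sum>i\<in>Basis. 1 * ((i \<bullet> x) * (i \<bullet> x))) = r\<^sup>2"
        by (auto simp: power2_norm_eq_inner euclidean_inner[of x x] inner_commute)
    qed
    then show ?thesis by (simp add: sphere_average_const[OF r])
  qed
  also have "\<dots> = real DIM('a) * k"
    by (subst sphere_average_sum[OF r]) (auto intro!: continuous_intros simp: sq)
  finally have kv: "k = r\<^sup>2 / real DIM('a)" by (simp add: field_simps)
  have ij: "sphere_average r (\<lambda>x. (i \<bullet> x) * (j \<bullet> x)) = i \<bullet> (k *\<^sub>R j)" if "i \<in> Basis" "j \<in> Basis" for i j :: 'a
  proof (cases "i = j")
    case True then show ?thesis using sq that by simp
  next
    case False then show ?thesis using that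
      by (subst sphere_average_inner_basis[OF r]) (auto intro!: continuous_intros simp: inner_reflect inner_Basis)
  qed
  have aj: "sphere_average r (\<lambda>x. (a \<bullet> x) * (j \<bullet> x)) = k * (a \<bullet> j)" if "j \<in> Basis" for a j :: 'a
    using that by (subst sphere_average_inner_linear[OF r _ ij]) (auto intro!: continuous_intros)
  have "sphere_average r (\<lambda>x. (b \<bullet> x) * (a \<bullet> x)) = b \<bullet> (k *\<^sub>R a)"
  proof (rule sphere_average_inner_linear[OF r])
    show "sphere_average r (\<lambda>x. (j \<bullet> x) * (a \<bullet> x)) = j \<bullet> (k *\<^sub>R a)" if "j \<in> Basis" for j
      using aj[OF that, of a] by (simp add: mult.commute[of "j \<bullet> _"] inner_commute[of j a])
  qed (intro continuous_intros)
  then show ?thesis by (simp add: mult.commute kv inner_commute)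
qed

text \<open>Among three basis vectors one always occurs an odd number of times, and reflecting its
  coordinate gives 0.\<close>

lemma sphere_average_inner3:
  fixes a b c :: "'a::euclidean_space"
  assumes r: "r > 0"
  shows "sphere_average r (\<lambda>x. (a \<bullet> x) * ((b \<bullet> x) * (c \<bullet> x))) = 0"
proof -
  have ijk: "sphere_average r (\<lambda>x. (i \<bullet> x) * ((j \<bullet> x) * (k \<bullet> x))) = i \<bullet> 0"
    if "i \<in> Basis" "j \<in> Basis" "k \<in> Basis" for i j k :: 'a
  proof (cases "j = i \<longleftrightarrow> k = i")
    \<comment> \<open>Here \<open>i\<close> occurs once or three times; in the other case it occurs
      exactly twice, and the remaining vector \<open>l\<close> occurs once.\<close>
    case True
    have "j \<bullet> (x - (2 * (x \<bullet> i)) *\<^sub>R i) * (k \<bullet> (x - (2 * (x \<bullet> i)) *\<^sub>R i)) = (j \<bullet> x) * (k \<bullet> x)" for x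
      using True that by (cases "j = i") (auto simp: inner_reflect inner_reflect_same simp del: inner_diff_right)
    then show ?thesis using that by (simp add: sphere_average_inner_basis[OF r] continuous_intros)
  next
    case False
    define l where "l = (if j = i then k else j)"
    have "sphere_average r (\<lambda>x. (l \<bullet> x) * ((i \<bullet> x) * (i \<bullet> x))) = 0"
      using False that unfolding l_def
      by (intro sphere_average_inner_basis[OF r]) (auto simp: inner_reflect intro!: continuous_intros)
    then show ?thesis using False by (auto simp: l_def mult_ac split: if_splits)
  qed
  have ajk: "sphere_average r (\<lambda>x. (j \<bullet> x) * ((a \<bullet> x) * (k \<bullet> x))) = j \<bullet> 0"
    if "j \<in> Basis" "k \<in> Basis" for a j k :: 'a
  proof -
    have "sphere_average r (\<lambda>x. (a \<bullet> x) * ((j \<bullet> x) * (k \<bullet> x))) = a \<bullet> 0"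
      by (rule sphere_average_inner_linear[OF r]; (intro continuous_intros | (rule ijk; simp add: that)))
    then show ?thesis by (simp add: mult_ac)
  qed
  have abk: "sphere_average r (\<lambda>x. (k \<bullet> x) * ((a \<bullet> x) * (b \<bullet> x))) = k \<bullet> 0"
    if "k \<in> Basis" for a b k :: 'a
  proof -
    have "sphere_average r (\<lambda>x. (b \<bullet> x) * ((a \<bullet> x) * (k \<bullet> x))) = b \<bullet> 0"
      by (rule sphere_average_inner_linear[OF r]; (intro continuous_intros | (rule ajk; simp add: that)))
    then show ?thesis by (simp add: mult_ac)
  qed
  have "sphere_average r (\<lambda>x. (a \<bullet> x) * ((b \<bullet> x) * (c \<bullet> x))) = a \<bullet> 0"
    by (rule sphere_average_inner_linear[OF r]; (intro continuous_intros | (rule abk; simp)))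
  then show ?thesis by simp
qed

text \<open>The Isserlis pattern of three pairings. The Gaussian comparison gives the ratio 3 to 1
  between fourth powers and products of two distinct squares; the scale \<open>C\<close> follows
  from \<open>(x \<bullet> x)\<^sup>2 = r ^ 4\<close>, whose expansion averages to \<open>C\<close>
  times \<open>D (D + 2)\<close> in dimension \<open>D\<close>.\<close>

lemma sphere_average_inner4:
  fixes a b c d :: "'a::euclidean_space"
  assumes r: "r > 0"
  shows "sphere_average r (\<lambda>x. (a \<bullet> x) * ((b \<bullet> x) * ((c \<bullet> x) * (d \<bullet> x))))
    = r ^ 4 / (real DIM('a) * (real DIM('a) + 2)) *
        ((a \<bullet> b) * (c \<bullet> d) + (a \<bullet> c) * (b \<bullet> d) + (a \<bullet> d) * (b \<bullet> c))"
proof -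
  let ?A = "\<lambda>i j k l :: 'a. sphere_average r (\<lambda>x. (i \<bullet> x) * ((j \<bullet> x) * ((k \<bullet> x) * (l \<bullet> x))))"
  obtain C where C: "\<And>e. (\<Sum>b\<in>Basis. e b) = 2 \<Longrightarrow> sphere_average r (\<lambda>x::'a. \<Prod>b\<in>Basis. (x \<bullet> b) ^ (2 * e b))
       = C * (\<Prod>b\<in>Basis. fact (2 * e b) / (2 ^ e b * fact (e b)))"
    using sphere_average_even_monomial[OF r, of 2] by blast
  have sq: "?A i i j j = (if i = j then 3 * C else C)" if i: "i \<in> Basis" and j: "j \<in> Basis" for i j
  proof -
    let ?e = "\<lambda>b. (if b = i then 1 else 0) + (if b = j then 1 else 0) :: nat"
    have m: "(\<Prod>b\<in>Basis. (x \<bullet> b) ^ (2 * ?e b)) = (i \<bullet> x) * ((i \<bullet> x) * ((j \<bullet> x) * (j \<bullet> x)))" for x :: 'a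
    proof -
      have "(\<Prod>b\<in>Basis. (x \<bullet> b) ^ (2 * ?e b))
          = (\<Prod>b\<in>Basis. (if b = i then (x \<bullet> b)\<^sup>2 else 1) * (if b = j then (x \<bullet> b)\<^sup>2 else 1))"
        by (intro prod.cong) (auto simp: power2_eq_square numeral_eq_Suc)
      then show ?thesis using i j by (simp add: prod.distrib power2_eq_square inner_commute mult.assoc)
    qed
    have v: "(\<Prod>b\<in>Basis. fact (2 * ?e b) / (2 ^ ?e b * fact (?e b))) = (if i = j then 3 else 1 :: real)"
    proof (cases "i = j")
      case True
      have "(\<Prod>b\<in>Basis. fact (2 * ?e b) / (2 ^ ?e b * fact (?e b))) = (\<Prod>b\<in>Basis. if b = i then 3 else 1 :: real)"
        using True by (intro prod.cong) (auto simp: numeral_eq_Suc)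
      then show ?thesis using True i by simp
    next
      case False
      then show ?thesis by (simp, intro prod.neutral) auto
    qed
    have "(\<Sum>b\<in>Basis. ?e b) = 2" using i j by (simp add: sum.distrib)
    from C[OF this] show ?thesis unfolding m v by (auto simp: mult_ac)
  qed
  have "r ^ 4 = sphere_average r (\<lambda>x::'a. \<Sum>p\<in>Basis \<times> Basis. 1 * ((fst p \<bullet> x) * ((fst p \<bullet> x) * ((snd p \<bullet> x) * (snd p \<bullet> x)))))"
  proof -
    have "sphere_average r (\<lambda>x::'a. \<Sum>p\<in>Basis \<times> Basis. 1 * ((fst p \<bullet> x) * ((fst p \<bullet> x) * ((snd p \<bullet> x) * (snd p \<bullet> x)))))
       = sphere_average r (\<lambda>_::'a. r ^ 4)"
    proof (rule sphere_average_cong)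
      fix x :: 'a assume n: "norm x = r"
      have "(\<Sum>p\<in>Basis \<times> Basis. 1 * ((fst p \<bullet> x) * ((fst p \<bullet> x) * ((snd p \<bullet> x) * (snd p \<bullet> x)))))
         = (\<Sum>i\<in>Basis. (i \<bullet> x) * (i \<bullet> x)) * (\<Sum>j\<in>Basis. (j \<bullet> x) * (j \<bullet> x))"
        by (simp add: sum_product sum.cartesian_product case_prod_beta mult.assoc)
      also have "(\<Sum>i\<in>Basis. (i \<bullet> x) * (i \<bullet> x)) = r\<^sup>2"
        using n by (auto simp: power2_norm_eq_inner euclidean_inner[of x x] inner_commute)
      finally show "(\<Sum>p\<in>Basis \<times> Basis. 1 * ((fst p \<bullet> x) * ((fst p \<bullet> x) * ((snd p \<bullet> x) * (snd p \<bullet> x))))) = r ^ 4"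
        by (simp add: power_add[symmetric])
    qed
    then show ?thesis by (simp add: sphere_average_const[OF r])
  qed
  also have "\<dots> = (\<Sum>p\<in>Basis \<times> (Basis::'a set). if fst p = snd p then 3 * C else C)"
    by (subst sphere_average_sum[OF r]) (auto intro!: continuous_intros sum.cong simp: sq)
  also have "\<dots> = (\<Sum>i\<in>Basis. \<Sum>j\<in>(Basis::'a set). C + (if i = j then 2 * C else 0))"
    by (simp add: sum.cartesian_product) (intro sum.cong, auto)
  also have "\<dots> = C * (real DIM('a) * (real DIM('a) + 2))"
    by (simp add: sum.distrib algebra_simps)
  finally have Cv: "C = r ^ 4 / (real DIM('a) * (real DIM('a) + 2))" 
    by (simp add: field_simps add_nonneg_eq_0_iff)
  let ?v = "\<lambda>j k l :: 'a. C *\<^sub>R ((k \<bullet> l) *\<^sub>R j + (j \<bullet> l) *\<^sub>R k + (j \<bullet> k) *\<^sub>R l)"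
  have single: "?A i j k l = 0" if "i \<in> Basis" "j \<in> Basis" "k \<in> Basis" "l \<in> Basis" "i \<noteq> j" "i \<noteq> k" "i \<noteq> l" for i j k l
    using that by (intro sphere_average_inner_basis[OF r]) (auto simp: inner_reflect intro!: continuous_intros)
  have ijkl: "?A i j k l = i \<bullet> ?v j k l"
    if B: "i \<in> Basis" "j \<in> Basis" "k \<in> Basis" "l \<in> Basis" for i j k l :: 'a
  proof -
    have perm: "?A i j k l = ?A j i k l" "?A i j k l = ?A k i j l" "?A i j k l = ?A l i j k"
      "?A i j k l = ?A i k j l" "?A i j k l = ?A i l j k"
      by (simp_all add: mult_ac)
    \<comment> \<open>Four indices either split into two equal pairs or contain one that differs
      from the other three, whose reflection gives 0.\<close>
    consider "i = j" "k = l" | "i = k" "j = l" | "i = l" "j = k" | "i \<noteq> j" "i \<noteq> k" "i \<noteq> l"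
      | "j \<noteq> i" "j \<noteq> k" "j \<noteq> l" | "k \<noteq> i" "k \<noteq> j" "k \<noteq> l" | "l \<noteq> i" "l \<noteq> j" "l \<noteq> k"
      by argo
    then show ?thesis
    proof cases
      case 1
      then show ?thesis using sq[of i k] B by (simp add: inner_Basis inner_add_right)
    next
      case 2
      then show ?thesis using sq[of i j] perm(4) B by (simp add: inner_Basis inner_add_right)
    next
      case 3
      then show ?thesis using sq[of i j] perm(5) B by (simp add: inner_Basis inner_add_right)
    next
      case 4
      then show ?thesis using single[of i j k l] B by (simp add: inner_Basis inner_add_right)
    next
      case 5
      then show ?thesis using single[of j i k l] perm(1) B by (simp add: inner_Basis inner_add_right)
    next
      case 6
      then show ?thesis using single[of k i j l] perm(2) B by (simp add: inner_Basis inner_add_right)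
    next
      case 7
      then show ?thesis using single[of l i j k] perm(3) B by (simp add: inner_Basis inner_add_right)
    qed
  qed
  have ajkl: "?A j a k l = j \<bullet> ?v a k l" if "j \<in> Basis" "k \<in> Basis" "l \<in> Basis" for a j k l :: 'a
  proof -
    have "?A a j k l = a \<bullet> ?v j k l"
      by (rule sphere_average_inner_linear[OF r]; (intro continuous_intros | (rule ijkl; simp add: that)))
    moreover have "?A j a k l = ?A a j k l" by (simp add: mult_ac)
    ultimately show ?thesis by (simp add: inner_add_right inner_commute mult_ac add_ac)
  qed
  have abkl: "?A k a b l = k \<bullet> ?v a b l" if "k \<in> Basis" "l \<in> Basis" for a b k l :: 'a
  proof -
    have "?A b k a l = b \<bullet> ?v k a l"
    proof (rule sphere_average_inner_linear[OF r])
      show "?A i k a l = i \<bullet> ?v k a l" if "i \<in> Basis" for i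
        using ajkl[of i k l a] that \<open>k \<in> Basis\<close> \<open>l \<in> Basis\<close>
        by (simp add: mult.left_commute inner_add_right inner_commute mult_ac add_ac)
    qed (intro continuous_intros)
    moreover have "?A k a b l = ?A b k a l" by (simp add: mult_ac)
    ultimately show ?thesis by (simp add: inner_add_right inner_commute mult_ac add_ac)
  qed
  have abcl: "?A l a b c = l \<bullet> ?v a b c" if "l \<in> Basis" for a b c l :: 'a
  proof -
    have "?A c l a b = c \<bullet> ?v l a b"
    proof (rule sphere_average_inner_linear[OF r])
      show "?A i l a b = i \<bullet> ?v l a b" if "i \<in> Basis" for i
      proof -
        have "?A i l a b = ?A i a b l" by (simp add: mult_ac)
        with abkl[OF that \<open>l \<in> Basis\<close>, of a b] show ?thesis
          by (simp add: inner_add_right inner_commute mult_ac add_ac)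
      qed
    qed (intro continuous_intros)
    moreover have "?A l a b c = ?A c l a b" by (simp add: mult_ac)
    ultimately show ?thesis by (simp add: inner_add_right inner_commute mult_ac add_ac)
  qed
  have "?A a b c d = a \<bullet> ?v b c d"
    by (rule sphere_average_inner_linear[OF r]; (intro continuous_intros | (rule abcl; simp)))
  then show ?thesis by (simp add: Cv inner_add_right mult_ac add_ac)
qed

section \<open>Polynomials of degree at most four\<close>

lemma polynomial_of_degree_le_monomial:
  assumes "(\<Sum>i\<in>UNIV. e i) \<le> t"
  shows "polynomial_of_degree_le t (\<lambda>x::real^'n. \<Prod>i\<in>UNIV. (x $ i) ^ e i)"
  unfolding polynomial_of_degree_le_def
proof (intro exI ext)
  show "(\<Prod>i\<in>UNIV. (x $ i) ^ e i)
      = (\<Sum>e'\<in>exponents_upto t. (if e' = e then 1 else 0) * (\<Prod>i\<in>UNIV. (x $ i) ^ e' i))" for x :: "real^'n"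
  proof -
    have "(\<Sum>e'\<in>exponents_upto t. (if e' = e then 1 else 0) * (\<Prod>i\<in>UNIV. (x $ i) ^ e' i))
       = (\<Sum>e'\<in>exponents_upto t. if e' = e then \<Prod>i\<in>UNIV. (x $ i) ^ e' i else 0)"
      by (rule sum.cong) auto
    also have "\<dots> = (\<Prod>i\<in>UNIV. (x $ i) ^ e i)"
    proof -
      have "e \<in> exponents_upto t" using assms by (simp add: exponents_upto_def)
      then show ?thesis by (simp add: finite_exponents_upto)
    qed
    finally show ?thesis by simp
  qed
qed

lemma polynomial_of_degree_le_sum:
  fixes f :: "'i \<Rightarrow> real^'n \<Rightarrow> real"
  assumes "\<And>i. i \<in> I \<Longrightarrow> polynomial_of_degree_le t (f i)"
  shows "polynomial_of_degree_le t (\<lambda>x. \<Sum>i\<in>I. a i * f i x)"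
proof -
  obtain c where c: "\<And>i. i \<in> I \<Longrightarrow> f i = (\<lambda>x. \<Sum>e\<in>exponents_upto t. c i e * (\<Prod>j\<in>UNIV. (x $ j) ^ e j))"
    using assms unfolding polynomial_of_degree_le_def by metis
  have "(\<Sum>i\<in>I. a i * f i x) = (\<Sum>e\<in>exponents_upto t. (\<Sum>i\<in>I. a i * c i e) * (\<Prod>j\<in>UNIV. (x $ j) ^ e j))" for x
  proof -
    have "(\<Sum>i\<in>I. a i * f i x) = (\<Sum>i\<in>I. \<Sum>e\<in>exponents_upto t. a i * c i e * (\<Prod>j\<in>UNIV. (x $ j) ^ e j))"
      by (intro sum.cong refl) (simp add: c sum_distrib_left mult.assoc)
    also have "\<dots> = (\<Sum>e\<in>exponents_upto t. \<Sum>i\<in>I. a i * c i e * (\<Prod>j\<in>UNIV. (x $ j) ^ e j))"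
      by (rule sum.swap)
    finally show ?thesis by (simp add: sum_distrib_right)
  qed
  then show ?thesis
    unfolding polynomial_of_degree_le_def by (intro exI ext)
qed

lemma polynomial_of_degree_le_1: "polynomial_of_degree_le t (\<lambda>_::real^'n. 1)"
  using polynomial_of_degree_le_monomial[of "\<lambda>_. 0" t] by simp

lemma polynomial_of_degree_le_inner_mult:
  fixes f :: "real^'n \<Rightarrow> real"
  assumes "polynomial_of_degree_le t f"
  shows "polynomial_of_degree_le (Suc t) (\<lambda>x. (a \<bullet> x) * f x)"
proof -
  obtain c where c: "f = (\<lambda>x. \<Sum>e\<in>exponents_upto t. c e * (\<Prod>i\<in>UNIV. (x $ i) ^ e i))"
    using assms unfolding polynomial_of_degree_le_def by blast
  let ?m = "\<lambda>p (x::real^'n). \<Prod>i\<in>UNIV. (x $ i) ^ (snd p i + (if i = fst p then 1 else 0))"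
  have m: "?m (i, e) x = x $ i * (\<Prod>j\<in>UNIV. (x $ j) ^ e j)" for i e x
  proof -
    have "?m (i, e) x = (\<Prod>j\<in>UNIV. (x $ j) ^ e j * (if j = i then x $ j else 1))"
      by (intro prod.cong) auto
    then show ?thesis by (simp add: prod.distrib mult.commute)
  qed
  have "(a \<bullet> x) * f x = (\<Sum>p\<in>UNIV \<times> exponents_upto t. (a $ fst p * c (snd p)) * ?m p x)" for x
  proof -
    have "(a \<bullet> x) * f x = (\<Sum>i\<in>UNIV. \<Sum>e\<in>exponents_upto t. (a $ i * c e) * ?m (i, e) x)"
      unfolding m by (simp add: c inner_vec_def sum_product mult_ac)
    then show ?thesis by (simp add: sum.cartesian_product case_prod_beta)
  qed
  moreover have "polynomial_of_degree_le (Suc t) (\<lambda>x. \<Sum>p\<in>UNIV \<times> exponents_upto t. (a $ fst p * c (snd p)) * ?m p x)"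
    by (intro polynomial_of_degree_le_sum polynomial_of_degree_le_monomial)
      (auto simp: exponents_upto_def sum.distrib)
  ultimately show ?thesis by simp
qed

text \<open>The inserted factor is constant on each centred sphere, with a value that tells two
  concentric spheres apart.\<close>

lemma polynomial_of_degree_le_norm_mult:
  fixes f :: "real^'n \<Rightarrow> real"
  assumes "polynomial_of_degree_le t f"
  shows "polynomial_of_degree_le (Suc (Suc t)) (\<lambda>x. (x \<bullet> x) * f x)"
proof -
  have "(x \<bullet> x) * f x = (\<Sum>i\<in>UNIV. 1 * ((axis i 1 \<bullet> x) * ((axis i 1 \<bullet> x) * f x)))" for x :: "real^'n"
    by (simp add: inner_vec_def[of x x] inner_axis' sum_distrib_right mult.assoc)
  moreover have "polynomial_of_degree_le (Suc (Suc t))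
      (\<lambda>x::real^'n. \<Sum>i\<in>UNIV. 1 * ((axis i 1 \<bullet> x) * ((axis i 1 \<bullet> x) * f x)))"
    by (intro polynomial_of_degree_le_sum polynomial_of_degree_le_inner_mult assms)
  ultimately show ?thesis by simp
qed

lemma polynomial_of_degree_le_inner:
  fixes a b c d :: "real^'n"
  shows "polynomial_of_degree_le 4 (\<lambda>x. a \<bullet> x)"
    "polynomial_of_degree_le 4 (\<lambda>x. (a \<bullet> x) * (b \<bullet> x))"
    "polynomial_of_degree_le 4 (\<lambda>x. (a \<bullet> x) * ((b \<bullet> x) * (c \<bullet> x)))"
    "polynomial_of_degree_le 4 (\<lambda>x. (a \<bullet> x) * ((b \<bullet> x) * ((c \<bullet> x) * (d \<bullet> x))))"
    "polynomial_of_degree_le 4 (\<lambda>x. (x \<bullet> x) * (a \<bullet> x))"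
    "polynomial_of_degree_le 4 (\<lambda>x. (x \<bullet> x) * ((a \<bullet> x) * (b \<bullet> x)))"
proof -
  have 1: "polynomial_of_degree_le (Suc t) (\<lambda>x. a \<bullet> x)" for t and a :: "real^'n"
    using polynomial_of_degree_le_inner_mult[OF polynomial_of_degree_le_1, of t a] by simp
  note 2 = polynomial_of_degree_le_inner_mult[OF 1]
  note 3 = polynomial_of_degree_le_inner_mult[OF 2]
  note 4 = polynomial_of_degree_le_inner_mult[OF 3]
  have four: "4 = Suc (Suc (Suc (Suc 0)))" by simp
  show "polynomial_of_degree_le 4 (\<lambda>x. a \<bullet> x)"
    "polynomial_of_degree_le 4 (\<lambda>x. (a \<bullet> x) * (b \<bullet> x))"
    "polynomial_of_degree_le 4 (\<lambda>x. (a \<bullet> x) * ((b \<bullet> x) * (c \<bullet> x)))"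
    "polynomial_of_degree_le 4 (\<lambda>x. (a \<bullet> x) * ((b \<bullet> x) * ((c \<bullet> x) * (d \<bullet> x))))"
    "polynomial_of_degree_le 4 (\<lambda>x. (x \<bullet> x) * (a \<bullet> x))"
    "polynomial_of_degree_le 4 (\<lambda>x. (x \<bullet> x) * ((a \<bullet> x) * (b \<bullet> x)))"
    unfolding four
    by (rule 1 2 3 4 polynomial_of_degree_le_norm_mult[OF 1] polynomial_of_degree_le_norm_mult[OF 2])+
qed

text \<open>With lists of coordinates the degree becomes a length, so that degree at most 4 is a
  finite case distinction.\<close>

lemma monomial_eq_prod_list:
  fixes e :: "'n::finite \<Rightarrow> nat"
  shows "\<exists>l. length l = (\<Sum>i\<in>UNIV. e i) \<and> (\<forall>x::real^'n. (\<Prod>i\<in>UNIV. (x $ i) ^ e i) = prod_list (map (($) x) l))"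
proof (induction "\<Sum>i\<in>UNIV. e i" arbitrary: e)
  case 0
  then show ?case by (intro exI[of _ "[]"]) auto
next
  case (Suc d)
  then have "\<exists>i. e i > 0" by (metis gr0I nat.simps(3) sum.neutral)
  then obtain i where i: "e i > 0" by blast
  define e' where "e' j = e j - (if j = i then 1 else 0)" for j
  have e: "e j = e' j + (if j = i then 1 else 0)" for j
    using i by (simp add: e'_def)
  have "d = (\<Sum>j\<in>UNIV. e' j)"
    using Suc(2) by (simp add: e sum.distrib)
  from Suc(1)[OF this] obtain l where l: "length l = d"
    "\<And>x::real^'n. (\<Prod>j\<in>UNIV. (x $ j) ^ e' j) = prod_list (map (($) x) l)"
    using \<open>d = _\<close> by blast
  have "(\<Prod>j\<in>UNIV. (x $ j) ^ e j) = prod_list (map (($) x) (i # l))" for x :: "real^'n"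
  proof -
    have "(\<Prod>j\<in>UNIV. (x $ j) ^ e j) = (\<Prod>j\<in>UNIV. (x $ j) ^ e' j * (if j = i then x $ j else 1))"
      by (intro prod.cong) (auto simp: e)
    then show ?thesis by (simp add: prod.distrib l mult.commute)
  qed
  moreover have "length (i # l) = (\<Sum>j\<in>UNIV. e j)"
    using l Suc(2) by simp
  ultimately show ?case by blast
qed

text \<open>Coordinates are inner products with \<open>axis i 1\<close>, so every monomial of degree
  at most 4 is among the tested products. Linearity is asked for continuous summands because
  \<open>sphere_average_sum\<close> provides it in that form.\<close>

lemma polynomial_of_degree_le_4_eqI:
  fixes L M :: "(real^'n \<Rightarrow> real) \<Rightarrow> real"
  assumes L: "\<And>(I :: ('n \<Rightarrow> nat) set) c f. (\<And>e. e \<in> I \<Longrightarrow> continuous_on UNIV (f e)) \<Longrightarrow>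
      L (\<lambda>x. \<Sum>e\<in>I. c e * f e x) = (\<Sum>e\<in>I. c e * L (f e))"
    and M: "\<And>(I :: ('n \<Rightarrow> nat) set) c f. (\<And>e. e \<in> I \<Longrightarrow> continuous_on UNIV (f e)) \<Longrightarrow>
      M (\<lambda>x. \<Sum>e\<in>I. c e * f e x) = (\<Sum>e\<in>I. c e * M (f e))"
    and 0: "L (\<lambda>_. 1) = M (\<lambda>_. 1)"
    and 1: "\<And>a. L (\<lambda>x. a \<bullet> x) = M (\<lambda>x. a \<bullet> x)"
    and 2: "\<And>a b. L (\<lambda>x. (a \<bullet> x) * (b \<bullet> x)) = M (\<lambda>x. (a \<bullet> x) * (b \<bullet> x))"
    and 3: "\<And>a b c. L (\<lambda>x. (a \<bullet> x) * ((b \<bullet> x) * (c \<bullet> x))) = M (\<lambda>x. (a \<bullet> x) * ((b \<bullet> x) * (c \<bullet> x)))"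
    and 4: "\<And>a b c d. L (\<lambda>x. (a \<bullet> x) * ((b \<bullet> x) * ((c \<bullet> x) * (d \<bullet> x))))
                    = M (\<lambda>x. (a \<bullet> x) * ((b \<bullet> x) * ((c \<bullet> x) * (d \<bullet> x))))"
    and f: "polynomial_of_degree_le 4 f"
  shows "L f = M f"
proof -
  obtain c where c: "f = (\<lambda>x. \<Sum>e\<in>exponents_upto 4. c e * (\<Prod>i\<in>UNIV. (x $ i) ^ e i))"
    using f unfolding polynomial_of_degree_le_def by blast
  have mono: "L (\<lambda>x. \<Prod>i\<in>UNIV. (x $ i) ^ e i) = M (\<lambda>x. \<Prod>i\<in>UNIV. (x $ i) ^ e i)"
    if "e \<in> exponents_upto 4" for e :: "'n \<Rightarrow> nat"
  proof -
    obtain l where len: "length l = (\<Sum>i\<in>UNIV. e i)"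
      and l: "\<And>x::real^'n. (\<Prod>i\<in>UNIV. (x $ i) ^ e i) = prod_list (map (($) x) l)"
      using monomial_eq_prod_list[of e] by blast
    have "length l \<le> 4"
      using that len by (simp add: exponents_upto_def)
    then have "l = [] \<or> (\<exists>i. l = [i]) \<or> (\<exists>i j. l = [i, j]) \<or> (\<exists>i j k. l = [i, j, k]) \<or> (\<exists>i j k m. l = [i, j, k, m])"
      by (auto simp: le_Suc_eq numeral_eq_Suc length_Suc_conv)
    then show ?thesis
      using 0 1[of "axis _ 1"] 2[of "axis _ 1" "axis _ 1"] 3[of "axis _ 1" "axis _ 1" "axis _ 1"]
        4[of "axis _ 1" "axis _ 1" "axis _ 1" "axis _ 1"]
      unfolding l by (auto simp: inner_axis')
  qed
  have cont: "continuous_on UNIV (\<lambda>x::real^'n. \<Prod>i\<in>UNIV. (x $ i) ^ e i)" for e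
    by (intro continuous_intros)
  show ?thesis
    unfolding c by (subst L[OF cont], subst M[OF cont]) (simp add: mono)
qed

section \<open>Designs in terms of moments\<close>

text \<open>For a finite nonempty subset of the unit sphere this is the spherical 3-design property,
  expressed by moments.\<close>

definition moments3 :: "(real^'n) set \<Rightarrow> bool" where
  "moments3 Y \<longleftrightarrow> (\<forall>a. (\<Sum>y\<in>Y. a \<bullet> y) = 0)
     \<and> (\<forall>a b. (\<Sum>y\<in>Y. (a \<bullet> y) * (b \<bullet> y)) = real (card Y) / real CARD('n) * (a \<bullet> b))
     \<and> (\<forall>a b c. (\<Sum>y\<in>Y. (a \<bullet> y) * ((b \<bullet> y) * (c \<bullet> y))) = 0)"

text \<open>The fourth moment tensor of the uniform distribution on the unit sphere.\<close>

definition pairings :: "real^'n \<Rightarrow> real^'n \<Rightarrow> real^'n \<Rightarrow> real^'n \<Rightarrow> real" where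
  "pairings a b c d = ((a \<bullet> b) * (c \<bullet> d) + (a \<bullet> c) * (b \<bullet> d) + (a \<bullet> d) * (b \<bullet> c))
     / (real CARD('n) * (real CARD('n) + 2))"

lemma sphere_average_inner4':
  fixes a :: "real^'n"
  assumes "r > 0"
  shows "sphere_average r (\<lambda>x. (a \<bullet> x) * ((b \<bullet> x) * ((c \<bullet> x) * (d \<bullet> x)))) = r ^ 4 * pairings a b c d"
  using sphere_average_inner4[OF assms, of a b c d] by (simp add: pairings_def)

lemma spherical_design_4_iff_moments:
  fixes Y :: "(real^'n) set"
  assumes Y: "finite Y" "Y \<noteq> {}" "Y \<subseteq> sphere 0 1"
  shows "spherical_design 4 Y \<longleftrightarrow> moments3 Y \<and>
    (\<forall>a b c d. (\<Sum>y\<in>Y. (a \<bullet> y) * ((b \<bullet> y) * ((c \<bullet> y) * (d \<bullet> y)))) = real (card Y) * pairings a b c d)"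
    (is "?D \<longleftrightarrow> ?M")
proof
  have N: "real (card Y) > 0" using Y by (simp add: card_gt_0_iff)
  {
    assume ?D
    then have D: "(\<Sum>y\<in>Y. f y) = real (card Y) * sphere_average 1 f" if "polynomial_of_degree_le 4 f" for f
      using that N by (simp add: spherical_design_def field_simps)
    show ?M
      unfolding moments3_def
      by (simp add: D polynomial_of_degree_le_inner sphere_average_inner1 sphere_average_inner2
          sphere_average_inner3 sphere_average_inner4')
  next
    assume M: ?M
    have "(1 / real (card Y)) * (\<Sum>y\<in>Y. f y) = sphere_average 1 f" if "polynomial_of_degree_le 4 f" for f
      by (rule polynomial_of_degree_le_4_eqI[OF _ _ _ _ _ _ _ that])
        (use M N in \<open>simp_all add: moments3_def sphere_average_sum sphere_average_const sphere_average_inner1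
          sphere_average_inner2 sphere_average_inner3 sphere_average_inner4'
          sum.swap[of _ _ Y] sum_distrib_left sum_divide_distrib\<close>)
    then show ?D
      using Y by (simp add: spherical_design_def)
  }
qed

text \<open>The second layer is kept as \<open>Z\<close> on the unit sphere, so that the radius
  enters only through \<open>f (r *\<^sub>R z)\<close> and the weight. The two layers are disjoint
  because \<open>r \<noteq> 1\<close>, which splits the sum over the union.\<close>

lemma euclidean_design_iff_functional:
  fixes X Z :: "(real^'n) set" and w :: "real^'n \<Rightarrow> real"
  assumes fin: "finite X" "finite Z" and sub: "X \<subseteq> sphere 0 1" "Z \<subseteq> sphere 0 1"
    and r: "r > 0" "r \<noteq> 1" and v: "v > 0"
    and w: "\<forall>x\<in>X. w x = 1" "\<forall>x\<in>(*\<^sub>R) r ` Z. w x = v / r ^ 4"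
  shows "euclidean_design_two_spheres 4 1 r X ((*\<^sub>R) r ` Z) w \<longleftrightarrow>
    (\<forall>f. polynomial_of_degree_le 4 f \<longrightarrow>
       real (card X) * sphere_average 1 f + v / r ^ 4 * real (card Z) * sphere_average r f
         = (\<Sum>x\<in>X. f x) + v / r ^ 4 * (\<Sum>z\<in>Z. f (r *\<^sub>R z)))"
proof -
  have inj: "inj_on ((*\<^sub>R) r) Z"
    using r by (auto simp: inj_on_def)
  have disj: "X \<inter> (*\<^sub>R) r ` Z = {}"
    using sub r by fastforce
  have sX: "(\<Sum>x\<in>X. w x * g x) = (\<Sum>x\<in>X. g x)" for g
    by (rule sum.cong) (simp_all add: w)
  have sZ: "(\<Sum>x\<in>(*\<^sub>R) r ` Z. w x * g x) = v / r ^ 4 * (\<Sum>z\<in>Z. g (r *\<^sub>R z))" for g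
    by (simp add: sum.reindex[OF inj] w sum_distrib_left)
  have tot: "(\<Sum>x\<in>X. w x) = real (card X)" "(\<Sum>x\<in>(*\<^sub>R) r ` Z. w x) = v / r ^ 4 * real (card Z)"
    using sX[of "\<lambda>_. 1"] sZ[of "\<lambda>_. 1"] by simp_all
  have "(\<Sum>u\<in>X \<union> (*\<^sub>R) r ` Z. w u * f u) = (\<Sum>x\<in>X. f x) + v / r ^ 4 * (\<Sum>z\<in>Z. f (r *\<^sub>R z))" for f
    using fin disj by (simp add: sum.union_disjoint sX sZ)
  moreover have "(*\<^sub>R) r ` Z \<subseteq> sphere 0 r" using sub r by auto
  moreover have "\<forall>x\<in>X \<union> (*\<^sub>R) r ` Z. w x > 0" using w v r by auto
  ultimately show ?thesis
    using fin sub r by (simp add: euclidean_design_two_spheres_def tot)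
qed

text \<open>Up to degree 3 each layer satisfies its own identity, whatever its radius and weight.
  Only degree 4 couples the layers, and there \<open>r ^ 4\<close> cancels against the
  weight.\<close>

lemma euclidean_design_of_moments:
  fixes X Z :: "(real^'n) set" and w :: "real^'n \<Rightarrow> real"
  assumes fin: "finite X" "finite Z" and sub: "X \<subseteq> sphere 0 1" "Z \<subseteq> sphere 0 1"
    and r: "r > 0" "r \<noteq> 1" and v: "v > 0"
    and w: "\<forall>x\<in>X. w x = 1" "\<forall>x\<in>(*\<^sub>R) r ` Z. w x = v / r ^ 4"
    and X: "moments3 X" and Z: "moments3 Z"
    and XZ: "\<And>a b c d. (\<Sum>x\<in>X. (a \<bullet> x) * ((b \<bullet> x) * ((c \<bullet> x) * (d \<bullet> x))))
        + v * (\<Sum>x\<in>Z. (a \<bullet> x) * ((b \<bullet> x) * ((c \<bullet> x) * (d \<bullet> x))))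
      = (real (card X) + v * real (card Z)) * pairings a b c d"
  shows "euclidean_design_two_spheres 4 1 r X ((*\<^sub>R) r ` Z) w"
  unfolding euclidean_design_iff_functional[OF fin sub r v w]
proof (intro allI impI)
  fix f :: "real^'n \<Rightarrow> real" assume f: "polynomial_of_degree_le 4 f"
  have p1: "(\<Sum>z\<in>Z. r * (a \<bullet> z)) = r * (\<Sum>z\<in>Z. a \<bullet> z)" for a
    by (simp add: sum_distrib_left)
  have p2: "(\<Sum>z\<in>Z. r * (a \<bullet> z) * (r * (b \<bullet> z))) = r\<^sup>2 * (\<Sum>z\<in>Z. (a \<bullet> z) * (b \<bullet> z))" for a b
    by (simp add: sum_distrib_left power2_eq_square mult_ac)
  have p3: "(\<Sum>z\<in>Z. r * (a \<bullet> z) * (r * (b \<bullet> z) * (r * (c \<bullet> z)))) = r^3 * (\<Sum>z\<in>Z. (a \<bullet> z) * ((b \<bullet> z) * (c \<bullet> z)))" for a b c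
    by (simp add: sum_distrib_left power3_eq_cube mult_ac)
  have p4: "(\<Sum>z\<in>Z. r * (a \<bullet> z) * (r * (b \<bullet> z) * (r * (c \<bullet> z) * (r * (d \<bullet> z)))))
      = r^4 * (\<Sum>z\<in>Z. (a \<bullet> z) * ((b \<bullet> z) * ((c \<bullet> z) * (d \<bullet> z))))" for a b c d
    by (simp add: sum_distrib_left power4_eq_xxxx mult_ac)
  show "real (card X) * sphere_average 1 f + v / r ^ 4 * real (card Z) * sphere_average r f
     = (\<Sum>x\<in>X. f x) + v / r ^ 4 * (\<Sum>z\<in>Z. f (r *\<^sub>R z))"
  proof (rule polynomial_of_degree_le_4_eqI[OF _ _ _ _ _ _ _ f])
    fix I :: "('n \<Rightarrow> nat) set" and c and f :: "('n \<Rightarrow> nat) \<Rightarrow> real^'n \<Rightarrow> real"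
    assume "\<And>e. e \<in> I \<Longrightarrow> continuous_on UNIV (f e)"
    then show "real (card X) * sphere_average 1 (\<lambda>x. \<Sum>e\<in>I. c e * f e x)
          + v / r ^ 4 * real (card Z) * sphere_average r (\<lambda>x. \<Sum>e\<in>I. c e * f e x)
        = (\<Sum>e\<in>I. c e * (real (card X) * sphere_average 1 (f e) + v / r ^ 4 * real (card Z) * sphere_average r (f e)))"
      using r by (simp add: sphere_average_sum sum_distrib_left sum_divide_distrib distrib_left sum.distrib mult_ac)
    show "(\<Sum>x\<in>X. \<Sum>e\<in>I. c e * f e x) + v / r ^ 4 * (\<Sum>z\<in>Z. \<Sum>e\<in>I. c e * f e (r *\<^sub>R z))
        = (\<Sum>e\<in>I. c e * ((\<Sum>x\<in>X. f e x) + v / r ^ 4 * (\<Sum>z\<in>Z. f e (r *\<^sub>R z))))"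
      by (simp add: sum.swap[of _ I] sum_distrib_left sum_divide_distrib distrib_left sum.distrib mult_ac)
  next
    fix a b c d :: "real^'n"
    show "real (card X) * sphere_average 1 (\<lambda>x. a \<bullet> x * (b \<bullet> x * (c \<bullet> x * (d \<bullet> x)))) +
       v / r ^ 4 * real (card Z) * sphere_average r (\<lambda>x. a \<bullet> x * (b \<bullet> x * (c \<bullet> x * (d \<bullet> x)))) =
       (\<Sum>x\<in>X. a \<bullet> x * (b \<bullet> x * (c \<bullet> x * (d \<bullet> x)))) +
       v / r ^ 4 * (\<Sum>z\<in>Z. a \<bullet> r *\<^sub>R z * (b \<bullet> r *\<^sub>R z * (c \<bullet> r *\<^sub>R z * (d \<bullet> r *\<^sub>R z))))"
      unfolding inner_scaleR_right p4
      using XZ[of a b c d] r by (simp add: sphere_average_inner4' algebra_simps)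
  qed (unfold inner_scaleR_right p1 p2 p3, use X Z r in \<open>simp_all add: moments3_def sphere_average_const sphere_average_inner1
        sphere_average_inner2 sphere_average_inner3 algebra_simps\<close>)
qed

text \<open>Forms of degree 1 and 2 may be multiplied by \<open>x \<bullet> x\<close> within degree
  4, hence hold on each sphere. Degrees 3 and 4 leave no room for this factor and yield one
  combination each, with the coefficients \<open>r ^ 3\<close> and \<open>r ^ 4\<close> times
  \<open>v / r ^ 4\<close>.\<close>

lemma moments_of_euclidean_design:
  fixes X Z :: "(real^'n) set" and w :: "real^'n \<Rightarrow> real"
  assumes fin: "finite X" "finite Z" and sub: "X \<subseteq> sphere 0 1" "Z \<subseteq> sphere 0 1"
    and r: "r > 0" "r \<noteq> 1" and v: "v > 0"
    and w: "\<forall>x\<in>X. w x = 1" "\<forall>x\<in>(*\<^sub>R) r ` Z. w x = v / r ^ 4"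
    and D: "euclidean_design_two_spheres 4 1 r X ((*\<^sub>R) r ` Z) w"
  shows "(\<Sum>x\<in>X. a \<bullet> x) = 0" "(\<Sum>x\<in>Z. a \<bullet> x) = 0"
    and "(\<Sum>x\<in>X. (a \<bullet> x) * (b \<bullet> x)) = real (card X) / real CARD('n) * (a \<bullet> b)"
    and "(\<Sum>x\<in>Z. (a \<bullet> x) * (b \<bullet> x)) = real (card Z) / real CARD('n) * (a \<bullet> b)"
    and "(\<Sum>x\<in>X. (a \<bullet> x) * ((b \<bullet> x) * (c \<bullet> x))) + v / r * (\<Sum>x\<in>Z. (a \<bullet> x) * ((b \<bullet> x) * (c \<bullet> x))) = 0"
    and "(\<Sum>x\<in>X. (a \<bullet> x) * ((b \<bullet> x) * ((c \<bullet> x) * (d \<bullet> x))))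
        + v * (\<Sum>x\<in>Z. (a \<bullet> x) * ((b \<bullet> x) * ((c \<bullet> x) * (d \<bullet> x))))
      = (real (card X) + v * real (card Z)) * pairings a b c d"
proof -
  have F: "real (card X) * sphere_average 1 f + v / r ^ 4 * real (card Z) * sphere_average r f
         = (\<Sum>x\<in>X. f x) + v / r ^ 4 * (\<Sum>z\<in>Z. f (r *\<^sub>R z))" if "polynomial_of_degree_le 4 f" for f
    using D that unfolding euclidean_design_iff_functional[OF fin sub r v w] by blast
  have nX: "x \<bullet> x = 1" if "x \<in> X" for x
    using sub that by (auto simp: norm_eq_1)
  have nZ: "x \<bullet> x = 1" if "x \<in> Z" for x
    using sub that by (auto simp: norm_eq_1)
  have avg: "sphere_average s (\<lambda>x::real^'n. (x \<bullet> x) * g x) = s\<^sup>2 * sphere_average s g"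
    if "s > 0" "continuous_on UNIV g" for s g
  proof -
    \<comment> \<open>A sum with one term, so that \<open>sphere_average_sum\<close> pulls out the
      scalar.\<close>
    have "sphere_average s (\<lambda>x. (x \<bullet> x) * g x) = sphere_average s (\<lambda>x. \<Sum>i\<in>{()}. s\<^sup>2 * g x)"
      by (rule sphere_average_cong) (simp add: power2_norm_eq_inner[symmetric])
    also have "\<dots> = (\<Sum>i\<in>{()}. s\<^sup>2 * sphere_average s g)"
      using that by (intro sphere_average_sum) auto
    finally show ?thesis by simp
  qed
  have r2: "r\<^sup>2 \<noteq> 1" using r by (simp add: power2_eq_1_iff)
  \<comment> \<open>The same form with and without the factor \<open>x \<bullet> x\<close> separates the two spheres, as \<open>r\<^sup>2 \<noteq> 1\<close>.\<close>
  have sep: "p = 0 \<and> q = 0" if "p + q = 0" "p + r\<^sup>2 * q = 0" for p q :: real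
  proof -
    have "(r\<^sup>2 - 1) * q = (p + r\<^sup>2 * q) - (p + q)" by (simp add: algebra_simps)
    then have "(r\<^sup>2 - 1) * q = 0" using that by simp
    then show ?thesis using r2 that by auto
  qed
  have SX: "(\<Sum>x\<in>X. (x \<bullet> x) * g x) = (\<Sum>x\<in>X. g x)" for g
    by (rule sum.cong) (simp_all add: nX)
  have SZ: "(\<Sum>z\<in>Z. (r *\<^sub>R z \<bullet> r *\<^sub>R z) * g z) = r\<^sup>2 * (\<Sum>z\<in>Z. g z)" for g
    unfolding sum_distrib_left by (rule sum.cong) (simp_all add: nZ power2_eq_square)
  have sum1: "(\<Sum>z\<in>Z. a \<bullet> r *\<^sub>R z) = r * (\<Sum>z\<in>Z. a \<bullet> z)"
    by (simp add: sum_distrib_left)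
  have "(\<Sum>x\<in>X. a \<bullet> x) = 0 \<and> v / r ^ 4 * (\<Sum>z\<in>Z. a \<bullet> r *\<^sub>R z) = 0"
    using F[OF polynomial_of_degree_le_inner(1)[of a]] F[OF polynomial_of_degree_le_inner(5)[of a]] r
    unfolding SX SZ
    by (intro sep) (simp_all only: avg sphere_average_inner1 continuous_on_inner continuous_on_const continuous_on_id, simp_all add: mult_ac)
  then show "(\<Sum>x\<in>X. a \<bullet> x) = 0" "(\<Sum>x\<in>Z. a \<bullet> x) = 0"
    using r v unfolding sum1 by auto
  have sum2: "(\<Sum>z\<in>Z. (a \<bullet> r *\<^sub>R z) * (b \<bullet> r *\<^sub>R z)) = r\<^sup>2 * (\<Sum>z\<in>Z. (a \<bullet> z) * (b \<bullet> z))"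
    by (simp add: sum_distrib_left power2_eq_square mult_ac)
  let ?p = "(\<Sum>x\<in>X. (a \<bullet> x) * (b \<bullet> x)) - real (card X) / real CARD('n) * (a \<bullet> b)"
  let ?q = "v / r ^ 4 * ((\<Sum>z\<in>Z. (a \<bullet> r *\<^sub>R z) * (b \<bullet> r *\<^sub>R z)) - r\<^sup>2 * (real (card Z) / real CARD('n) * (a \<bullet> b)))"
  have "continuous_on UNIV (\<lambda>x. (a \<bullet> x) * (b \<bullet> x))" by (intro continuous_intros)
  then have "?p = 0 \<and> ?q = 0"
    using F[OF polynomial_of_degree_le_inner(2)[of a b]] F[OF polynomial_of_degree_le_inner(6)[of a b]] r
    unfolding SX SZ
    by (intro sep) (simp_all only: avg sphere_average_inner2, simp_all add: algebra_simps)
  then show "(\<Sum>x\<in>X. (a \<bullet> x) * (b \<bullet> x)) = real (card X) / real CARD('n) * (a \<bullet> b)"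
    "(\<Sum>x\<in>Z. (a \<bullet> x) * (b \<bullet> x)) = real (card Z) / real CARD('n) * (a \<bullet> b)"
    using r v unfolding sum2 right_diff_distrib[symmetric] by simp_all
  have "(\<Sum>z\<in>Z. (a \<bullet> r *\<^sub>R z) * ((b \<bullet> r *\<^sub>R z) * (c \<bullet> r *\<^sub>R z))) = r ^ 3 * (\<Sum>z\<in>Z. (a \<bullet> z) * ((b \<bullet> z) * (c \<bullet> z)))"
    by (simp add: sum_distrib_left power3_eq_cube mult_ac)
  then show "(\<Sum>x\<in>X. (a \<bullet> x) * ((b \<bullet> x) * (c \<bullet> x))) + v / r * (\<Sum>x\<in>Z. (a \<bullet> x) * ((b \<bullet> x) * (c \<bullet> x))) = 0"
    using F[OF polynomial_of_degree_le_inner(3)[of a b c]] r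
    by (simp add: sphere_average_inner3 power3_eq_cube power4_eq_xxxx)
  have "(\<Sum>z\<in>Z. (a \<bullet> r *\<^sub>R z) * ((b \<bullet> r *\<^sub>R z) * ((c \<bullet> r *\<^sub>R z) * (d \<bullet> r *\<^sub>R z))))
      = r ^ 4 * (\<Sum>z\<in>Z. (a \<bullet> z) * ((b \<bullet> z) * ((c \<bullet> z) * (d \<bullet> z))))"
    by (simp add: sum_distrib_left power4_eq_xxxx mult_ac)
  then show "(\<Sum>x\<in>X. (a \<bullet> x) * ((b \<bullet> x) * ((c \<bullet> x) * (d \<bullet> x))))
        + v * (\<Sum>x\<in>Z. (a \<bullet> x) * ((b \<bullet> x) * ((c \<bullet> x) * (d \<bullet> x))))
      = (real (card X) + v * real (card Z)) * pairings a b c d"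
    using F[OF polynomial_of_degree_le_inner(4)[of a b c d]] r
    by (simp add: sphere_average_inner4' algebra_simps)
qed

text \<open>The hyperplane orthogonal to \<open>y0\<close> has the dimension of
  \<open>real^'n\<close>; the isometry bridges the otherwise unrelated index types.\<close>

lemma hyperplane_isometry:
  fixes y0 :: "real^'m"
  assumes y0: "norm y0 = 1" and m: "CARD('m) = CARD('n::finite) + 1"
  obtains E :: "real^'n \<Rightarrow> real^'m" where "linear E" "\<And>x y. E x \<bullet> E y = x \<bullet> y"
    "\<And>x. y0 \<bullet> E x = 0" "\<And>z. y0 \<bullet> z = 0 \<Longrightarrow> \<exists>x. z = E x"
proof -
  have "dim (UNIV :: (real^'n) set) = dim {z. y0 \<bullet> z = 0}"
    using y0 m by (subst dim_hyperplane) auto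
  then obtain E :: "real^'n \<Rightarrow> real^'m" where E: "linear E" "E ` UNIV = {z. y0 \<bullet> z = 0}"
    "\<And>x. norm (E x) = norm x"
    using isometries_subspaces[OF subspace_UNIV subspace_hyperplane] by (metis UNIV_I)
  have "E x \<bullet> E y = x \<bullet> y" for x y
    by (simp add: dot_norm linear_add[OF E(1), symmetric] E(3))
  moreover have "y0 \<bullet> E x = 0" for x using E(2) by blast
  moreover have "\<exists>x. z = E x" if "y0 \<bullet> z = 0" for z using E(2) that by blast
  ultimately show thesis using that E(1) by blast
qed

text \<open>The summands are inner products of test vectors with components \<open>t\<close> and
  \<open>a\<close> along and across an axis with the points at height \<open>p\<close> of a layer of
  radius \<open>s\<close>. Odd powers of \<open>x\<close> drop out; degree 4 retains the fourth
  moments of \<open>Z\<close>, which \<open>moments3\<close> does not determine.\<close>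

lemma moments3_affine:
  fixes Z :: "(real^'n) set"
  assumes Z: "moments3 Z"
  shows "(\<Sum>x\<in>Z. t1 * p + s * (a1 \<bullet> x)) = real (card Z) * (p * t1)"
    and "(\<Sum>x\<in>Z. (t1 * p + s * (a1 \<bullet> x)) * (t2 * p + s * (a2 \<bullet> x)))
      = real (card Z) * (p\<^sup>2 * (t1 * t2) + s\<^sup>2 / real CARD('n) * (a1 \<bullet> a2))"
    and "(\<Sum>x\<in>Z. (t1 * p + s * (a1 \<bullet> x)) * ((t2 * p + s * (a2 \<bullet> x)) * (t3 * p + s * (a3 \<bullet> x))))
      = real (card Z) * (p ^ 3 * (t1 * t2 * t3) + p * s\<^sup>2 / real CARD('n) *
          (t1 * (a2 \<bullet> a3) + t2 * (a1 \<bullet> a3) + t3 * (a1 \<bullet> a2)))"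
    and "(\<Sum>x\<in>Z. (t1 * p + s * (a1 \<bullet> x)) * ((t2 * p + s * (a2 \<bullet> x)) *
          ((t3 * p + s * (a3 \<bullet> x)) * (t4 * p + s * (a4 \<bullet> x)))))
      = real (card Z) * (p ^ 4 * (t1 * t2 * t3 * t4) + p\<^sup>2 * s\<^sup>2 / real CARD('n) *
          (t1 * t2 * (a3 \<bullet> a4) + t1 * t3 * (a2 \<bullet> a4) + t1 * t4 * (a2 \<bullet> a3)
           + t2 * t3 * (a1 \<bullet> a4) + t2 * t4 * (a1 \<bullet> a3) + t3 * t4 * (a1 \<bullet> a2)))
        + s ^ 4 * (\<Sum>x\<in>Z. (a1 \<bullet> x) * ((a2 \<bullet> x) * ((a3 \<bullet> x) * (a4 \<bullet> x))))"
proof -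
  have 1: "(\<Sum>x\<in>Z. a \<bullet> x) = 0"
    and 2: "(\<Sum>x\<in>Z. (a \<bullet> x) * (b \<bullet> x)) = real (card Z) / real CARD('n) * (a \<bullet> b)"
    and 3: "(\<Sum>x\<in>Z. (a \<bullet> x) * ((b \<bullet> x) * (c \<bullet> x))) = 0" for a b c
    using Z unfolding moments3_def by blast+
  have c1: "(\<Sum>x\<in>Z. k * (a \<bullet> x)) = 0" for k a
    using 1[of a] by (simp add: sum_distrib_left[symmetric])
  have c2: "(\<Sum>x\<in>Z. k * ((a \<bullet> x) * (b \<bullet> x))) = k * (real (card Z) / real CARD('n) * (a \<bullet> b))" for k a b
    using 2[of a b] by (simp add: sum_distrib_left[symmetric])
  have c3: "(\<Sum>x\<in>Z. k * ((a \<bullet> x) * ((b \<bullet> x) * (c \<bullet> x)))) = 0" for k a b c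
    using 3[of a b c] by (simp add: sum_distrib_left[symmetric])
  show "(\<Sum>x\<in>Z. t1 * p + s * (a1 \<bullet> x)) = real (card Z) * (p * t1)"
    by (simp add: sum.distrib c1)
  have "(\<Sum>x\<in>Z. (t1 * p + s * (a1 \<bullet> x)) * (t2 * p + s * (a2 \<bullet> x)))
    = (\<Sum>x\<in>Z. p\<^sup>2 * (t1 * t2) + (t1 * p * s) * (a2 \<bullet> x) + (t2 * p * s) * (a1 \<bullet> x)
        + s\<^sup>2 * ((a1 \<bullet> x) * (a2 \<bullet> x)))"
    by (rule sum.cong) (auto simp: algebra_simps power2_eq_square)
  then show "(\<Sum>x\<in>Z. (t1 * p + s * (a1 \<bullet> x)) * (t2 * p + s * (a2 \<bullet> x)))
      = real (card Z) * (p\<^sup>2 * (t1 * t2) + s\<^sup>2 / real CARD('n) * (a1 \<bullet> a2))"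
    by (simp only: sum.distrib c1 c2 sum_constant) (simp add: algebra_simps)
  have "(\<Sum>x\<in>Z. (t1 * p + s * (a1 \<bullet> x)) * ((t2 * p + s * (a2 \<bullet> x)) * (t3 * p + s * (a3 \<bullet> x))))
    = (\<Sum>x\<in>Z. p ^ 3 * (t1 * t2 * t3) + (t1 * t2 * p\<^sup>2 * s) * (a3 \<bullet> x) + (t1 * t3 * p\<^sup>2 * s) * (a2 \<bullet> x)
        + (t2 * t3 * p\<^sup>2 * s) * (a1 \<bullet> x)
        + (t1 * p * s\<^sup>2) * ((a2 \<bullet> x) * (a3 \<bullet> x)) + (t2 * p * s\<^sup>2) * ((a1 \<bullet> x) * (a3 \<bullet> x))
        + (t3 * p * s\<^sup>2) * ((a1 \<bullet> x) * (a2 \<bullet> x))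
        + s ^ 3 * ((a1 \<bullet> x) * ((a2 \<bullet> x) * (a3 \<bullet> x))))"
    by (rule sum.cong) (auto simp: algebra_simps power2_eq_square power3_eq_cube)
  then show "(\<Sum>x\<in>Z. (t1 * p + s * (a1 \<bullet> x)) * ((t2 * p + s * (a2 \<bullet> x)) * (t3 * p + s * (a3 \<bullet> x))))
      = real (card Z) * (p ^ 3 * (t1 * t2 * t3) + p * s\<^sup>2 / real CARD('n) *
          (t1 * (a2 \<bullet> a3) + t2 * (a1 \<bullet> a3) + t3 * (a1 \<bullet> a2)))"
    by (simp only: sum.distrib c1 c2 c3 sum_constant) (simp add: algebra_simps add_divide_distrib)
  have "(\<Sum>x\<in>Z. (t1 * p + s * (a1 \<bullet> x)) * ((t2 * p + s * (a2 \<bullet> x)) *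
          ((t3 * p + s * (a3 \<bullet> x)) * (t4 * p + s * (a4 \<bullet> x)))))
    = (\<Sum>x\<in>Z. p ^ 4 * (t1 * t2 * t3 * t4)
        + (t1 * t2 * t3 * p ^ 3 * s) * (a4 \<bullet> x) + (t1 * t2 * t4 * p ^ 3 * s) * (a3 \<bullet> x)
        + (t1 * t3 * t4 * p ^ 3 * s) * (a2 \<bullet> x) + (t2 * t3 * t4 * p ^ 3 * s) * (a1 \<bullet> x)
        + (t1 * t2 * p\<^sup>2 * s\<^sup>2) * ((a3 \<bullet> x) * (a4 \<bullet> x)) + (t1 * t3 * p\<^sup>2 * s\<^sup>2) * ((a2 \<bullet> x) * (a4 \<bullet> x))
        + (t1 * t4 * p\<^sup>2 * s\<^sup>2) * ((a2 \<bullet> x) * (a3 \<bullet> x)) + (t2 * t3 * p\<^sup>2 * s\<^sup>2) * ((a1 \<bullet> x) * (a4 \<bullet> x))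
        + (t2 * t4 * p\<^sup>2 * s\<^sup>2) * ((a1 \<bullet> x) * (a3 \<bullet> x)) + (t3 * t4 * p\<^sup>2 * s\<^sup>2) * ((a1 \<bullet> x) * (a2 \<bullet> x))
        + (t1 * p * s ^ 3) * ((a2 \<bullet> x) * ((a3 \<bullet> x) * (a4 \<bullet> x)))
        + (t2 * p * s ^ 3) * ((a1 \<bullet> x) * ((a3 \<bullet> x) * (a4 \<bullet> x)))
        + (t3 * p * s ^ 3) * ((a1 \<bullet> x) * ((a2 \<bullet> x) * (a4 \<bullet> x)))
        + (t4 * p * s ^ 3) * ((a1 \<bullet> x) * ((a2 \<bullet> x) * (a3 \<bullet> x)))
        + s ^ 4 * ((a1 \<bullet> x) * ((a2 \<bullet> x) * ((a3 \<bullet> x) * (a4 \<bullet> x)))))"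
    by (rule sum.cong) (auto simp: algebra_simps power2_eq_square power3_eq_cube power4_eq_xxxx)
  then show "(\<Sum>x\<in>Z. (t1 * p + s * (a1 \<bullet> x)) * ((t2 * p + s * (a2 \<bullet> x)) *
          ((t3 * p + s * (a3 \<bullet> x)) * (t4 * p + s * (a4 \<bullet> x)))))
      = real (card Z) * (p ^ 4 * (t1 * t2 * t3 * t4) + p\<^sup>2 * s\<^sup>2 / real CARD('n) *
          (t1 * t2 * (a3 \<bullet> a4) + t1 * t3 * (a2 \<bullet> a4) + t1 * t4 * (a2 \<bullet> a3)
           + t2 * t3 * (a1 \<bullet> a4) + t2 * t4 * (a1 \<bullet> a3) + t3 * t4 * (a1 \<bullet> a2)))
        + s ^ 4 * (\<Sum>x\<in>Z. (a1 \<bullet> x) * ((a2 \<bullet> x) * ((a3 \<bullet> x) * (a4 \<bullet> x))))"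
    by (simp only: sum.distrib c1 c2 c3 sum_constant sum_distrib_left) (simp add: algebra_simps add_divide_distrib)
qed

lemma cubic_moments_zero:
  fixes X :: "(real^'n) set"
  assumes "(\<Sum>x\<in>X. \<Sum>y\<in>X. (x \<bullet> y) ^ 3) = 0"
  shows "(\<Sum>x\<in>X. (a \<bullet> x) * ((b \<bullet> x) * (c \<bullet> x))) = 0"
proof -
  \<comment> \<open>The hypothesis says that the squared norm of the tensor \<open>T\<close>, the sum of all \<open>x \<otimes> x \<otimes> x\<close>, is \<open>0\<close>.\<close>
  define T where "T p = (\<Sum>x\<in>X. x $ fst p * (x $ fst (snd p) * x $ snd (snd p)))" for p :: "'n \<times> 'n \<times> 'n"
  have triple: "(a \<bullet> x) * ((b \<bullet> x) * (c \<bullet> x))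
      = (\<Sum>p\<in>UNIV. (a $ fst p * (b $ fst (snd p) * c $ snd (snd p))) * (x $ fst p * (x $ fst (snd p) * x $ snd (snd p))))"
    for a b c x :: "real^'n"
  proof -
    have "(a \<bullet> x) * ((b \<bullet> x) * (c \<bullet> x)) = (\<Sum>i\<in>UNIV. \<Sum>p\<in>UNIV. (a $ i * x $ i) * ((b $ fst p * x $ fst p) * (c $ snd p * x $ snd p)))"
      by (simp add: inner_vec_def sum_product sum.cartesian_product case_prod_beta UNIV_Times_UNIV)
    then show ?thesis
      by (simp add: sum.cartesian_product case_prod_beta UNIV_Times_UNIV mult_ac)
  qed
  have "(\<Sum>x\<in>X. \<Sum>y\<in>X. (x \<bullet> y) ^ 3) = (\<Sum>x\<in>X. \<Sum>y\<in>X. (x \<bullet> y) * ((x \<bullet> y) * (x \<bullet> y)))"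
    by (simp add: power3_eq_cube mult.assoc)
  also have "\<dots> = (\<Sum>p\<in>UNIV. T p * T p)"
    unfolding triple T_def sum_product
    by (subst sum.swap[of _ UNIV]) (subst sum.swap[of _ UNIV], rule refl)
  finally have "(\<Sum>p\<in>UNIV. T p * T p) = 0" using assms by simp
  then have T0: "T p = 0" for p
    by (cases p) (simp add: sum_nonneg_eq_0_iff)
  have "(\<Sum>x\<in>X. (a \<bullet> x) * ((b \<bullet> x) * (c \<bullet> x))) = (\<Sum>p\<in>UNIV. (a $ fst p * (b $ fst (snd p) * c $ snd (snd p))) * T p)"
    unfolding triple T_def sum_distrib_left by (rule sum.swap)
  then show ?thesis by (simp add: T0)
qed

lemma two_by_two_zero:
  fixes p q \<alpha> \<beta> :: real
  assumes "p + q = 0" "\<beta> * p + \<alpha> * q = 0" "\<alpha> \<noteq> \<beta>"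
  shows "p = 0" "q = 0"
proof -
  have "(\<alpha> - \<beta>) * q = (\<beta> * p + \<alpha> * q) - \<beta> * (p + q)" by (simp add: algebra_simps)
  then have "(\<alpha> - \<beta>) * q = 0" using assms by simp
  then show "q = 0" using assms by simp
  then show "p = 0" using assms by simp
qed

section \<open>The parameters\<close>

text \<open>\<open>n\<close> is the dimension of the Euclidean design, \<open>N\<close> the size of a tight design on the sphere \<open>S\<^sup>n\<close>,
  \<open>c\<^sub>X\<close> and \<open>c\<^sub>Z\<close> are the sizes of its layers at heights \<open>\<beta>\<close> and \<open>\<alpha>\<close>, and \<open>v\<close> is the weight of the second
  layer before its rescaling.  \<open>L\<close> is opaque only to stop the simplifier from multiplying out \<open>K - 1\<close>.\<close>

locale parameters =
  fixes K :: real
  assumes K: "K \<ge> 2"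
begin

definition "\<alpha> = 1 / (2 * K)"
definition "L = K - 1"
definition "\<beta> = - 1 / (2 * L)"
definition "n = (2 * K - 1)\<^sup>2 - 4"
definition "N = (n + 1) * (n + 4) / 2"
definition "c\<^sub>X = 2 * (2 * K + 1) * L ^ 3"
definition "c\<^sub>Z = 2 * K ^ 3 * (2 * K - 3)"
definition "v = ((2 * K + 1)\<^sup>2 * L ^ 4) / ((2 * K - 3)\<^sup>2 * K ^ 4)"

lemma n_eq: "n = (2 * K - 3) * (2 * K + 1)"
  by (simp add: n_def power2_eq_square algebra_simps)

lemma nz: "K \<noteq> 0" "L \<noteq> 0" "2 * K - 3 \<noteq> 0" "2 * K + 1 \<noteq> 0" "2 * K - 1 \<noteq> 0"
  using K by (auto simp: L_def)

lemma n_ge: "n \<ge> 5"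
proof -
  have "3 ^ 2 \<le> (2 * K - 1)\<^sup>2" using K by (intro power_mono) auto
  then show ?thesis by (simp add: n_def)
qed

lemma \<alpha>_neq_\<beta>: "\<alpha> \<noteq> \<beta>"
proof -
  have "\<alpha> > 0" "\<beta> < 0" using K by (simp_all add: \<alpha>_def \<beta>_def L_def divide_neg_pos)
  then show ?thesis by simp
qed

lemma one_minus_\<alpha>2: "1 - \<alpha>\<^sup>2 = (2 * K - 1) * (2 * K + 1) / (4 * K\<^sup>2)"
  using nz by (simp add: \<alpha>_def power_divide power_mult_distrib field_simps power2_eq_square)

lemma one_minus_\<beta>2: "1 - \<beta>\<^sup>2 = (2 * K - 3) * (2 * K - 1) / (4 * L\<^sup>2)"
proof -
  have "1 - \<beta>\<^sup>2 = (4 * L\<^sup>2 - 1) / (4 * L\<^sup>2)"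
    using nz by (simp add: \<beta>_def power_divide power_mult_distrib field_simps)
  also have "4 * L\<^sup>2 - 1 = (2 * K - 3) * (2 * K - 1)"
    unfolding L_def by algebra
  finally show ?thesis .
qed

lemma one_minus_pos: "1 - \<alpha>\<^sup>2 > 0" "1 - \<beta>\<^sup>2 > 0"
  using K nz unfolding one_minus_\<alpha>2 one_minus_\<beta>2 by (auto intro!: divide_pos_pos mult_pos_pos)

lemma v_eq: "v = (1 - \<alpha>\<^sup>2)\<^sup>2 / (1 - \<beta>\<^sup>2)\<^sup>2"
proof -
  \<comment> \<open>Free variables keep the factors from being multiplied out; \<open>a\<close>
    stands for \<open>2 * K - 1\<close>, which is common to both radii and cancels.\<close>
  have "(b\<^sup>2 * l ^ 4) / (c\<^sup>2 * k ^ 4) = (a * b / (4 * k\<^sup>2))\<^sup>2 / (c * a / (4 * l\<^sup>2))\<^sup>2"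
    if "a \<noteq> 0" "c \<noteq> 0" "k \<noteq> 0" "l \<noteq> 0" for a b c k l :: real
    using that by (simp add: field_simps power2_eq_square power4_eq_xxxx)
  from this[of "2 * K - 1" "2 * K - 3" K L "2 * K + 1"] nz show ?thesis
    unfolding one_minus_\<alpha>2 one_minus_\<beta>2 v_def by blast
qed

lemma v_pos: "v > 0"
  using one_minus_pos by (simp add: v_eq)

lemma n1: "n + 1 = 2 * (2 * K\<^sup>2 - 2 * K - 1)" and n3: "n + 3 = 4 * K * L" and n4: "n + 4 = (2 * K - 1)\<^sup>2"
  by (simp_all add: n_def L_def power2_eq_square algebra_simps)

text \<open>Together with the \<open>moment\<close>, \<open>cross\<close> and \<open>pure\<close>
  lemmas below, these are the design equations for \<open>y0\<close> and its two layers: with all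
  factors along \<open>y0\<close>, two factors orthogonal to it, or all four.
  \<open>c\<^sub>X\<close> and \<open>c\<^sub>Z\<close> are the solution of this equation and
  \<open>moment1\<close>; the higher ones are verified for them.\<close>

lemma card_sum: "1 + c\<^sub>X + c\<^sub>Z = N"
  unfolding N_def n1 n4 c\<^sub>X_def c\<^sub>Z_def L_def by algebra

lemma moment1: "1 + c\<^sub>X * \<beta> + c\<^sub>Z * \<alpha> = 0"
proof -
  have "c\<^sub>X * \<beta> = - (2 * K + 1) * L\<^sup>2" "c\<^sub>Z * \<alpha> = K\<^sup>2 * (2 * K - 3)"
    using nz by (simp_all add: c\<^sub>X_def c\<^sub>Z_def \<alpha>_def \<beta>_def field_simps power2_eq_square power3_eq_cube)
  then show ?thesis by (simp add: L_def power2_eq_square algebra_simps)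
qed

lemma weighted_squares: "c\<^sub>X * \<beta>\<^sup>2 = (2 * K + 1) * L / 2" "c\<^sub>Z * \<alpha>\<^sup>2 = K * (2 * K - 3) / 2"
  using nz by (simp_all add: c\<^sub>X_def c\<^sub>Z_def \<alpha>_def \<beta>_def power_divide power_mult_distrib power2_eq_square power3_eq_cube)

lemma moment2: "1 + c\<^sub>X * \<beta>\<^sup>2 + c\<^sub>Z * \<alpha>\<^sup>2 = N / (n + 1)"
proof -
  have eq: "N / (n + 1) = (2 * K - 1)\<^sup>2 / 2"
    unfolding n4[symmetric] using n_ge by (simp add: N_def field_simps)
  show ?thesis unfolding weighted_squares eq by (simp add: L_def power2_eq_square field_simps)
qed

text \<open>A unit vector at height \<open>p\<close> has an orthogonal part of squared length
  \<open>1 - p\<^sup>2\<close>, which a layer spreads evenly over \<open>n\<close> directions, while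
  \<open>y0\<close> contributes nothing. Hence the \<open>cross\<close> identities follow from the
  moments of the heights.\<close>

lemma cross2: "(c\<^sub>X * (1 - \<beta>\<^sup>2) + c\<^sub>Z * (1 - \<alpha>\<^sup>2)) / n = N / (n + 1)"
proof -
  have "c\<^sub>X * (1 - \<beta>\<^sup>2) + c\<^sub>Z * (1 - \<alpha>\<^sup>2) = N - N / (n + 1)"
    using card_sum moment2 by (simp add: algebra_simps)
  also have "\<dots> = n * (N / (n + 1))" using n_ge by (simp add: field_simps)
  finally show ?thesis using n_ge by simp
qed

lemma moment3: "1 + c\<^sub>X * \<beta> ^ 3 + c\<^sub>Z * \<alpha> ^ 3 = 0"
proof -
  have eqs: "c\<^sub>X * \<beta> ^ 3 = - (2 * K + 1) / 4" "c\<^sub>Z * \<alpha> ^ 3 = (2 * K - 3) / 4"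
    using nz by (simp_all add: c\<^sub>X_def c\<^sub>Z_def \<alpha>_def \<beta>_def power_divide power_mult_distrib field_simps)
  show ?thesis unfolding eqs by (simp add: field_simps)
qed

lemma cross3: "c\<^sub>X * (\<beta> * (1 - \<beta>\<^sup>2)) + c\<^sub>Z * (\<alpha> * (1 - \<alpha>\<^sup>2)) = 0"
  using moment1 moment3 by (simp add: algebra_simps power2_eq_square power3_eq_cube)

lemma N_quot: "N / ((n + 1) * (n + 3)) = (2 * K - 1)\<^sup>2 / (8 * K * L)"
  using n_ge n3 nz by (simp add: N_def n4 divide_simps)

lemma moment4: "1 + c\<^sub>X * \<beta> ^ 4 + c\<^sub>Z * \<alpha> ^ 4 = 3 * (N / ((n + 1) * (n + 3)))"
proof -
  have "c\<^sub>X * \<beta> ^ 4 = (2 * K + 1) / (8 * L)" "c\<^sub>Z * \<alpha> ^ 4 = (2 * K - 3) / (8 * K)"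
    using nz by (simp_all add: c\<^sub>X_def c\<^sub>Z_def \<alpha>_def \<beta>_def power_divide power_mult_distrib power4_eq_xxxx
        power3_eq_cube field_simps)
  moreover have "1 + (2 * K + 1) / (8 * L) + (2 * K - 3) / (8 * K) = 3 * ((2 * K - 1)\<^sup>2 / (8 * K * L))"
    using nz by (simp add: divide_simps) (simp add: L_def power2_eq_square algebra_simps)
  ultimately show ?thesis unfolding N_quot by simp
qed

lemma cross4: "(c\<^sub>X * (\<beta>\<^sup>2 * (1 - \<beta>\<^sup>2)) + c\<^sub>Z * (\<alpha>\<^sup>2 * (1 - \<alpha>\<^sup>2))) / n = N / ((n + 1) * (n + 3))"
proof -
  have "c\<^sub>X * (\<beta>\<^sup>2 * (1 - \<beta>\<^sup>2)) + c\<^sub>Z * (\<alpha>\<^sup>2 * (1 - \<alpha>\<^sup>2)) = N / (n + 1) - 3 * (N / ((n + 1) * (n + 3)))"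
    using moment2 moment4 by (simp add: algebra_simps flip: power_add)
  also have "N / (n + 1) = (n + 3) * (N / ((n + 1) * (n + 3)))" using n_ge by simp
  also have "\<dots> - 3 * (N / ((n + 1) * (n + 3))) = n * (N / ((n + 1) * (n + 3)))"
    by (simp only: left_diff_distrib[symmetric]) simp
  finally show ?thesis using n_ge by simp
qed

text \<open>Expanding the squares reduces the claim to the moments of order 0, 2 and 4 of the
  heights and to \<open>(n + 1) (n + 3) - 2 (n + 3) + 3 = n (n + 2)\<close>.\<close>

lemma pure4: "((1 - \<beta>\<^sup>2)\<^sup>2 * c\<^sub>X + (1 - \<alpha>\<^sup>2)\<^sup>2 * c\<^sub>Z) / (n * (n + 2)) = N / ((n + 1) * (n + 3))"
proof -
  define Q where "Q = N / ((n + 1) * (n + 3))"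
  have "N / (n + 1) = (n + 3) * Q" "N = (n + 1) * (n + 3) * Q"
    using n_ge by (simp_all add: Q_def)
  then have "(1 - \<beta>\<^sup>2)\<^sup>2 * c\<^sub>X + (1 - \<alpha>\<^sup>2)\<^sup>2 * c\<^sub>Z = ((n + 1) * (n + 3) - 2 * (n + 3) + 3) * Q"
    using card_sum moment2 moment4[folded Q_def] by (simp add: algebra_simps power2_eq_square power4_eq_xxxx)
  also have "\<dots> = (n * (n + 2)) * Q" by (simp add: algebra_simps)
  finally show ?thesis using n_ge by (simp add: Q_def)
qed

text \<open>Times \<open>(n + 1) / 2\<close>, the quadratic is the sum of the reproducing kernels of
  harmonic degrees 0, 1 and 2 on the sphere in dimension \<open>n + 1\<close>; its value at 1 is
  then \<open>N\<close>.\<close>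

lemma quadratic_roots: "(n + 3) * t\<^sup>2 + 2 * t - 1 = 0 \<longleftrightarrow> t = \<alpha> \<or> t = \<beta>"
proof -
  have "(n + 3) * t\<^sup>2 + 2 * t - 1 = (2 * K * t - 1) * (2 * L * t + 1)"
    unfolding n3 by (simp add: L_def power2_eq_square algebra_simps)
  moreover have "2 * K * t - 1 = 0 \<longleftrightarrow> t = \<alpha>" "2 * L * t + 1 = 0 \<longleftrightarrow> t = \<beta>"
    using nz by (auto simp: \<alpha>_def \<beta>_def field_simps)
  ultimately show ?thesis by simp
qed

text \<open>\<open>(u - p\<^sup>2) / (1 - p\<^sup>2)\<close> is the inner product, after rescaling
  to the unit sphere, of two points at height \<open>p\<close> whose inner product was
  \<open>u\<close>.\<close>

lemma quotients:
  "(\<beta> - \<beta>\<^sup>2) / (1 - \<beta>\<^sup>2) = - (1 / (2 * K - 3))"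
  "(\<alpha> - \<beta>\<^sup>2) / (1 - \<beta>\<^sup>2) = (K - 2) / (K * (2 * K - 3))"
  "(\<alpha> - \<alpha>\<^sup>2) / (1 - \<alpha>\<^sup>2) = 1 / (2 * K + 1)"
  "(\<beta> - \<alpha>\<^sup>2) / (1 - \<alpha>\<^sup>2) = - ((K + 1) / (L * (2 * K + 1)))"
proof -
  have a: "\<alpha>\<^sup>2 = 1 / (4 * K\<^sup>2)" and b: "\<beta>\<^sup>2 = 1 / (4 * L\<^sup>2)"
    by (simp_all add: \<alpha>_def \<beta>_def power_divide power_mult_distrib)
  have 1: "\<beta> - \<beta>\<^sup>2 = - (2 * K - 1) / (4 * L\<^sup>2)"
    unfolding b using nz by (simp add: \<beta>_def divide_simps power2_eq_square) (simp add: L_def algebra_simps)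
  have 2: "\<alpha> - \<beta>\<^sup>2 = (2 * K - 1) * (K - 2) / (4 * K * L\<^sup>2)"
    unfolding b using nz by (simp add: \<alpha>_def divide_simps power2_eq_square) (simp add: L_def algebra_simps)
  have 3: "\<alpha> - \<alpha>\<^sup>2 = (2 * K - 1) / (4 * K\<^sup>2)"
    unfolding a using nz by (simp add: \<alpha>_def divide_simps power2_eq_square)
  have 4: "\<beta> - \<alpha>\<^sup>2 = - ((2 * K - 1) * (K + 1)) / (4 * K\<^sup>2 * L)"
    unfolding a using nz by (simp add: \<beta>_def divide_simps power2_eq_square) (simp add: L_def algebra_simps)
  show "(\<beta> - \<beta>\<^sup>2) / (1 - \<beta>\<^sup>2) = - (1 / (2 * K - 3))"
    "(\<alpha> - \<beta>\<^sup>2) / (1 - \<beta>\<^sup>2) = (K - 2) / (K * (2 * K - 3))"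
    unfolding 1 2 one_minus_\<beta>2 using nz by (simp_all add: divide_simps)
  show "(\<alpha> - \<alpha>\<^sup>2) / (1 - \<alpha>\<^sup>2) = 1 / (2 * K + 1)"
    "(\<beta> - \<alpha>\<^sup>2) / (1 - \<alpha>\<^sup>2) = - ((K + 1) / (L * (2 * K + 1)))"
    unfolding 3 4 one_minus_\<alpha>2 using nz by (simp_all add: divide_simps)
qed

text \<open>The same conversion between the heights \<beta> and \<alpha>. The two values are
  opposite because \<alpha> + \<beta> = 2 \<alpha> \<beta>, by Vieta for the quadratic of
  \<open>quadratic_roots\<close>.\<close>

lemma mixed_quotients:
  "(\<alpha> - \<beta> * \<alpha>) / (sqrt (1 - \<beta>\<^sup>2) * sqrt (1 - \<alpha>\<^sup>2)) = 1 / sqrt n"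
  "(\<beta> - \<beta> * \<alpha>) / (sqrt (1 - \<beta>\<^sup>2) * sqrt (1 - \<alpha>\<^sup>2)) = - (1 / sqrt n)"
proof -
  have "sqrt (1 - \<beta>\<^sup>2) * sqrt (1 - \<alpha>\<^sup>2) = sqrt (n * ((2 * K - 1) / (4 * K * L))\<^sup>2)"
    unfolding real_sqrt_mult[symmetric] one_minus_\<beta>2 one_minus_\<alpha>2 n_eq
    by (intro arg_cong[where f = sqrt]) (simp add: power_divide power_mult_distrib power2_eq_square mult_ac)
  also have "\<dots> = sqrt n * ((2 * K - 1) / (4 * K * L))"
    using K by (simp add: real_sqrt_mult L_def)
  finally have s: "sqrt (1 - \<beta>\<^sup>2) * sqrt (1 - \<alpha>\<^sup>2) = sqrt n * ((2 * K - 1) / (4 * K * L))" .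
  have a: "\<alpha> - \<beta> * \<alpha> = (2 * K - 1) / (4 * K * L)"
    using nz by (simp add: \<alpha>_def \<beta>_def divide_simps) (simp add: L_def)
  have b: "\<beta> - \<beta> * \<alpha> = - ((2 * K - 1) / (4 * K * L))"
    using nz by (simp add: \<alpha>_def \<beta>_def divide_simps)
  show "(\<alpha> - \<beta> * \<alpha>) / (sqrt (1 - \<beta>\<^sup>2) * sqrt (1 - \<alpha>\<^sup>2)) = 1 / sqrt n"
    "(\<beta> - \<beta> * \<alpha>) / (sqrt (1 - \<beta>\<^sup>2) * sqrt (1 - \<alpha>\<^sup>2)) = - (1 / sqrt n)"
    unfolding s a b using nz n_ge by (simp_all add: field_simps)
qed

end

section \<open>Stacking two layers\<close>

lemma (in parameters) tight_inner_products:
  fixes Y :: "(real^'m) set"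
  assumes m: "real CARD('m) = n + 1" and Y: "tight_spherical_4_design Y"
    and xy: "x \<in> Y" "y \<in> Y" "x \<noteq> y"
  shows "x \<bullet> y = \<alpha> \<or> x \<bullet> y = \<beta>"
proof -
  have D: "spherical_design 4 Y" and cY: "real (card Y) = N"
    using Y by (simp_all add: tight_spherical_4_design_def m N_def algebra_simps)
  then have fin: "finite Y" "Y \<noteq> {}" "Y \<subseteq> sphere 0 1"
    by (auto simp: spherical_design_def)
  have xx: "x \<bullet> x = 1" using xy fin by (auto simp: norm_eq_1)
  have S: "(\<Sum>y\<in>Y. x \<bullet> y) = 0" "(\<Sum>y\<in>Y. (x \<bullet> y)\<^sup>2) = N / (n + 1)" "(\<Sum>y\<in>Y. (x \<bullet> y) ^ 3) = 0"
      "(\<Sum>y\<in>Y. (x \<bullet> y) ^ 4) = N * (3 / ((n + 1) * (n + 3)))"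
    using D unfolding spherical_design_4_iff_moments[OF fin] moments3_def
    by (simp_all add: power2_eq_square power3_eq_cube power4_eq_xxxx mult.assoc cY m xx pairings_def add_ac)
  \<comment> \<open>By the design property the squares of the kernel \<open>(n + 3) t\<^sup>2 + 2 t - 1\<close> at \<open>t = x \<bullet> y\<close> sum to the
    term with \<open>y = x\<close> alone.\<close>
  define g where "g y = ((n + 3) * (x \<bullet> y)\<^sup>2 + 2 * (x \<bullet> y) - 1)\<^sup>2" for y
  have "(\<Sum>y\<in>Y. g y) = (\<Sum>y\<in>Y. (n + 3)\<^sup>2 * (x \<bullet> y) ^ 4 + (4 * (n + 3)) * (x \<bullet> y) ^ 3
      + (4 - 2 * (n + 3)) * (x \<bullet> y)\<^sup>2 + (- 4) * (x \<bullet> y) + 1)"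
    unfolding g_def by (rule sum.cong[OF refl]) algebra
  also have "\<dots> = (n + 3)\<^sup>2 * (N * (3 / ((n + 1) * (n + 3)))) + (4 - 2 * (n + 3)) * (N / (n + 1)) + N"
    by (simp only: sum.distrib sum_distrib_left[symmetric] S) (simp add: cY)
  \<comment> \<open>Tightness enters here: the sum is \<open>2 * N * (n + 4) / (n + 1)\<close>, and
    it matches the diagonal term \<open>g x\<close> exactly for this \<open>N\<close>.\<close>
  also have "\<dots> = (n + 4)\<^sup>2"
  proof -
    have 1: "N / (n + 1) = (n + 4) / 2" using n_ge by (simp add: N_def field_simps)
    have "(n + 3)\<^sup>2 * (N * (3 / ((n + 1) * (n + 3)))) = 3 * (n + 3) * (N / (n + 1))"
      using n_ge by (simp add: power2_eq_square)
    then show ?thesis unfolding 1 by (simp add: N_def power2_eq_square field_simps)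
  qed
  also have "\<dots> = g x" by (simp add: g_def xx add.commute)
  finally have "(\<Sum>y\<in>Y - {x}. g y) = 0"
    using fin xy by (simp add: sum_diff1)
  then have "g y = 0"
    using fin xy by (subst (asm) sum_nonneg_eq_0_iff) (auto simp: g_def)
  then show ?thesis
    unfolding quadratic_roots[symmetric] by (simp add: g_def)
qed

text \<open>An orthogonal splitting of \<open>real^'m\<close> into the line of \<open>y0\<close> and
  a copy of \<open>real^'n\<close>. No design is assumed, so that both directions can work in
  it.\<close>

locale derived_designs = parameters +
  fixes y0 :: "real^'m" and E :: "real^'n \<Rightarrow> real^'m"
  assumes card_n: "real CARD('n) = n" and card_m: "real CARD('m) = n + 1"
    and y0: "norm y0 = 1" and E_linear: "linear E" and E_inner: "E x \<bullet> E y = x \<bullet> y"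
    and y0_E: "y0 \<bullet> E x = 0" and E_onto: "y0 \<bullet> z = 0 \<Longrightarrow> \<exists>x. z = E x"
begin

definition lift :: "real \<Rightarrow> real^'n \<Rightarrow> real^'m" where
  "lift p x = p *\<^sub>R y0 + sqrt (1 - p\<^sup>2) *\<^sub>R E x"

definition points :: "(real^'n) set \<Rightarrow> (real^'n) set \<Rightarrow> (real^'m) set" where
  "points X Z = insert y0 (lift \<beta> ` X \<union> lift \<alpha> ` Z)"

lemma y0_y0: "y0 \<bullet> y0 = 1"
  using y0 by (simp add: norm_eq_1)

text \<open>Brings inner products with a layer into the form of the summands of
  \<open>moments3_affine\<close>.\<close>

lemma inner_lift: "(t *\<^sub>R y0 + E a) \<bullet> lift p x = t * p + sqrt (1 - p\<^sup>2) * (a \<bullet> x)"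
  by (simp add: lift_def algebra_simps y0_y0 y0_E E_inner inner_commute[of "E a" y0])

lemma y0_lift: "y0 \<bullet> lift p x = p"
  by (simp add: lift_def inner_add_right y0_y0 y0_E)

lemma E_lift: "E a \<bullet> lift p x = sqrt (1 - p\<^sup>2) * (a \<bullet> x)"
  using inner_lift[of 0] by simp

lemma inner_split: "(t *\<^sub>R y0 + E a) \<bullet> (t' *\<^sub>R y0 + E a') = t * t' + a \<bullet> a'"
  by (simp add: algebra_simps y0_y0 y0_E E_inner inner_commute[of "E a" y0])

lemma lift_lift: "lift p x \<bullet> lift q z = p * q + sqrt (1 - p\<^sup>2) * sqrt (1 - q\<^sup>2) * (x \<bullet> z)"
  using inner_lift[of p "sqrt (1 - p\<^sup>2) *\<^sub>R x" q z] by (simp add: lift_def linear_cmul[OF E_linear])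

lemma split_vector: "\<exists>t a. b = t *\<^sub>R y0 + E a"
proof -
  have "y0 \<bullet> (b - (y0 \<bullet> b) *\<^sub>R y0) = 0"
    by (simp add: inner_diff_right y0_y0)
  then obtain a where "b - (y0 \<bullet> b) *\<^sub>R y0 = E a" using E_onto by blast
  then have "b = (y0 \<bullet> b) *\<^sub>R y0 + E a" by (simp add: algebra_simps)
  then show ?thesis by blast
qed

lemma inj_lift:
  assumes "1 - p\<^sup>2 > 0"
  shows "inj (lift p)"
proof (rule injI)
  fix x y assume "lift p x = lift p y"
  then have "E a \<bullet> lift p x = E a \<bullet> lift p y" for a by simp
  then have "a \<bullet> x = a \<bullet> y" for a using assms by (simp add: E_lift)
  then show "x = y" by (rule vector_eq_ldot[THEN iffD1, OF allI])
qed

lemma norm_lift: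
  assumes "1 - p\<^sup>2 > 0"
  shows "norm (lift p x) = 1 \<longleftrightarrow> norm x = 1"
proof -
  have "lift p x \<bullet> lift p x = 1 \<longleftrightarrow> (1 - p\<^sup>2) * (x \<bullet> x - 1) = 0"
    using assms by (simp add: lift_lift algebra_simps power2_eq_square del: mult_eq_0_iff)
  then show ?thesis using assms by (simp add: norm_eq_1)
qed

lemma lift_onto:
  assumes p: "1 - p\<^sup>2 > 0" and y: "y0 \<bullet> y = p"
  shows "\<exists>x. y = lift p x"
proof -
  obtain t a where ta: "y = t *\<^sub>R y0 + E a" using split_vector by blast
  have "t = p" using y by (simp add: ta inner_add_right y0_y0 y0_E)
  have "y = lift p ((1 / sqrt (1 - p\<^sup>2)) *\<^sub>R a)"
    using p by (simp add: lift_def ta \<open>t = p\<close> linear_cmul[OF E_linear])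
  then show ?thesis by blast
qed

lemma \<alpha>\<beta>_neq_1: "\<alpha> \<noteq> 1" "\<beta> \<noteq> 1"
  using one_minus_pos by auto

text \<open>The three pieces are told apart by their heights 1, \<beta> and \<alpha>.\<close>

lemma
  assumes fin: "finite X" "finite Z"
  shows sum_points: "(\<Sum>y\<in>points X Z. g y) = g y0 + (\<Sum>x\<in>X. g (lift \<beta> x)) + (\<Sum>z\<in>Z. g (lift \<alpha> z) :: real)"
    and card_points: "card (points X Z) = 1 + card X + card Z"
proof -
  have y: "y0 \<bullet> y = \<beta>" if "y \<in> lift \<beta> ` X" for y using that y0_lift by auto
  have z: "y0 \<bullet> y = \<alpha>" if "y \<in> lift \<alpha> ` Z" for y using that y0_lift by auto
  have d1: "lift \<beta> ` X \<inter> lift \<alpha> ` Z = {}" using y z \<alpha>_neq_\<beta> by force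
  have d2: "y0 \<notin> lift \<beta> ` X \<union> lift \<alpha> ` Z" using y[of y0] z[of y0] y0_y0 \<alpha>\<beta>_neq_1 by auto
  have i: "inj_on (lift \<beta>) X" "inj_on (lift \<alpha>) Z"
    using inj_lift one_minus_pos by (meson inj_on_subset subset_UNIV)+
  show "(\<Sum>y\<in>points X Z. g y) = g y0 + (\<Sum>x\<in>X. g (lift \<beta> x)) + (\<Sum>z\<in>Z. g (lift \<alpha> z))"
    using fin d1 d2 by (simp add: points_def sum.union_disjoint sum.reindex[OF i(1)] sum.reindex[OF i(2)])
  show "card (points X Z) = 1 + card X + card Z"
    using fin d1 d2 by (simp add: points_def card_Un_disjoint card_image[OF i(1)] card_image[OF i(2)])
qed

text \<open>With every test vector split as \<open>t *\<^sub>R y0 + E a\<close>, each design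
  identity becomes a polynomial identity in the \<open>t\<close> and the inner products of the
  \<open>a\<close>, whose coefficients are the equations of \<open>parameters\<close>.\<close>

lemma tight_design_points:
  assumes fin: "finite X" "finite Z" and sub: "X \<subseteq> sphere 0 1" "Z \<subseteq> sphere 0 1"
    and c: "real (card X) = c\<^sub>X" "real (card Z) = c\<^sub>Z"
    and X: "moments3 X" and Z: "moments3 Z"
    and XZ: "\<And>a b c d. (\<Sum>x\<in>X. (a \<bullet> x) * ((b \<bullet> x) * ((c \<bullet> x) * (d \<bullet> x))))
        + v * (\<Sum>x\<in>Z. (a \<bullet> x) * ((b \<bullet> x) * ((c \<bullet> x) * (d \<bullet> x)))) = (c\<^sub>X + v * c\<^sub>Z) * pairings a b c d"
  shows "tight_spherical_4_design (points X Z)"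
proof -
  have card: "real (card (points X Z)) = N"
    using card_points[OF fin] card_sum c by simp
  have sphere: "points X Z \<subseteq> sphere 0 1"
    using sub y0 norm_lift one_minus_pos by (auto simp: points_def)
  have finite: "finite (points X Z)" "points X Z \<noteq> {}"
    using fin by (auto simp: points_def)
  define A where "A = 1 - \<beta>\<^sup>2"
  define B where "B = 1 - \<alpha>\<^sup>2"
  have AB: "A > 0" "B > 0" using one_minus_pos by (simp_all add: A_def B_def)
  note cross = cross2[folded A_def B_def] cross3[folded A_def B_def] cross4[folded A_def B_def] pure4[folded A_def B_def]
  have sq: "(sqrt A)\<^sup>2 = A" "(sqrt B)\<^sup>2 = B" "sqrt A ^ 4 = A\<^sup>2" "sqrt B ^ 4 = B\<^sup>2"
    using AB by (simp_all add: power4_eq_xxxx power2_eq_square)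
  note expand = sum_points[OF fin] inner_lift inner_split A_def[symmetric] B_def[symmetric]
    moments3_affine[OF X] moments3_affine[OF Z] c card_n card_m card sq
  have y0i: "(t *\<^sub>R y0 + E a) \<bullet> y0 = t" for t a
    using inner_split[of t a 1 0] linear_0[OF E_linear] by simp
  have m1: "(\<Sum>y\<in>points X Z. a \<bullet> y) = 0" for a
  proof -
    obtain t1 a1 where a: "a = t1 *\<^sub>R y0 + E a1" using split_vector by blast
    have "(\<Sum>y\<in>points X Z. a \<bullet> y) = t1 * (1 + c\<^sub>X * \<beta> + c\<^sub>Z * \<alpha>)"
      unfolding a expand y0i by (simp add: algebra_simps)
    then show ?thesis by (simp add: moment1)
  qed
  have m2: "(\<Sum>y\<in>points X Z. (a \<bullet> y) * (b \<bullet> y)) = N / (n + 1) * (a \<bullet> b)" for a b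
  proof -
    obtain t1 a1 t2 a2 where a: "a = t1 *\<^sub>R y0 + E a1" "b = t2 *\<^sub>R y0 + E a2" using split_vector by metis
    have "(\<Sum>y\<in>points X Z. (a \<bullet> y) * (b \<bullet> y))
       = t1 * t2 * (1 + c\<^sub>X * \<beta>\<^sup>2 + c\<^sub>Z * \<alpha>\<^sup>2) + (a1 \<bullet> a2) * ((c\<^sub>X * A + c\<^sub>Z * B) / n)"
      unfolding a expand y0i by (simp add: algebra_simps add_divide_distrib)
    also have "\<dots> = N / (n + 1) * (t1 * t2 + a1 \<bullet> a2)"
      unfolding moment2 cross by (simp add: algebra_simps add_divide_distrib)
    finally show ?thesis by (simp only: a inner_split)
  qed
  have m3: "(\<Sum>y\<in>points X Z. (a \<bullet> y) * ((b \<bullet> y) * (c \<bullet> y))) = 0" for a b c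
  proof -
    obtain t1 a1 t2 a2 t3 a3 where a: "a = t1 *\<^sub>R y0 + E a1" "b = t2 *\<^sub>R y0 + E a2" "c = t3 *\<^sub>R y0 + E a3"
      using split_vector by metis
    have "(\<Sum>y\<in>points X Z. (a \<bullet> y) * ((b \<bullet> y) * (c \<bullet> y)))
       = t1 * t2 * t3 * (1 + c\<^sub>X * \<beta> ^ 3 + c\<^sub>Z * \<alpha> ^ 3)
         + (t1 * (a2 \<bullet> a3) + t2 * (a1 \<bullet> a3) + t3 * (a1 \<bullet> a2)) * ((c\<^sub>X * (\<beta> * A) + c\<^sub>Z * (\<alpha> * B)) / n)"
      unfolding a expand y0i by (simp add: algebra_simps add_divide_distrib)
    then show ?thesis unfolding moment3 cross by simp
  qed
  have m4: "(\<Sum>y\<in>points X Z. (a \<bullet> y) * ((b \<bullet> y) * ((c \<bullet> y) * (d \<bullet> y)))) = N * pairings a b c d" for a b c d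
  proof -
    obtain t1 a1 t2 a2 t3 a3 t4 a4 where a: "a = t1 *\<^sub>R y0 + E a1" "b = t2 *\<^sub>R y0 + E a2"
        "c = t3 *\<^sub>R y0 + E a3" "d = t4 *\<^sub>R y0 + E a4"
      using split_vector by metis
    define Q where "Q = N / ((n + 1) * (n + 3))"
    define SX where "SX = (\<Sum>x\<in>X. (a1 \<bullet> x) * ((a2 \<bullet> x) * ((a3 \<bullet> x) * (a4 \<bullet> x))))"
    define SZ where "SZ = (\<Sum>x\<in>Z. (a1 \<bullet> x) * ((a2 \<bullet> x) * ((a3 \<bullet> x) * (a4 \<bullet> x))))"
    define q where "q = (a1 \<bullet> a2) * (a3 \<bullet> a4) + (a1 \<bullet> a3) * (a2 \<bullet> a4) + (a1 \<bullet> a4) * (a2 \<bullet> a3)"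
    define q' where "q' = t1 * t2 * (a3 \<bullet> a4) + t1 * t3 * (a2 \<bullet> a4) + t1 * t4 * (a2 \<bullet> a3)
           + t2 * t3 * (a1 \<bullet> a4) + t2 * t4 * (a1 \<bullet> a3) + t3 * t4 * (a1 \<bullet> a2)"
    \<comment> \<open>The layers contribute fourth moments with factors \<open>A\<^sup>2\<close> and
      \<open>B\<^sup>2\<close>, so the weight \<open>v\<close> makes their sum a multiple of the
      combination in \<open>XZ\<close>.\<close>
    have vA: "A\<^sup>2 * v = B\<^sup>2" using AB v_eq by (simp add: A_def B_def)
    have "A\<^sup>2 * SX + B\<^sup>2 * SZ = A\<^sup>2 * (SX + v * SZ)"
      by (simp add: algebra_simps flip: vA)
    also have "SX + v * SZ = (c\<^sub>X + v * c\<^sub>Z) * pairings a1 a2 a3 a4"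
      unfolding SX_def SZ_def by (rule XZ)
    also have "A\<^sup>2 * \<dots> = (A\<^sup>2 * c\<^sub>X + B\<^sup>2 * c\<^sub>Z) * pairings a1 a2 a3 a4"
      by (simp add: algebra_simps flip: vA)
    also have "\<dots> = (A\<^sup>2 * c\<^sub>X + B\<^sup>2 * c\<^sub>Z) / (n * (n + 2)) * q"
      by (simp add: pairings_def card_n q_def)
    also have "\<dots> = Q * q" by (simp only: cross Q_def)
    finally have S: "A\<^sup>2 * SX + B\<^sup>2 * SZ = Q * q" .
    have "(\<Sum>y\<in>points X Z. (a \<bullet> y) * ((b \<bullet> y) * ((c \<bullet> y) * (d \<bullet> y))))
       = t1 * t2 * t3 * t4 + c\<^sub>X * (\<beta> ^ 4 * (t1 * t2 * t3 * t4) + \<beta>\<^sup>2 * A / n * q') + A\<^sup>2 * SX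
          + (c\<^sub>Z * (\<alpha> ^ 4 * (t1 * t2 * t3 * t4) + \<alpha>\<^sup>2 * B / n * q') + B\<^sup>2 * SZ)"
      unfolding a expand y0i SX_def SZ_def q'_def by (simp only: add_ac mult_ac)
    also have "\<dots> = t1 * t2 * t3 * t4 * (1 + c\<^sub>X * \<beta> ^ 4 + c\<^sub>Z * \<alpha> ^ 4)
        + q' * ((c\<^sub>X * (\<beta>\<^sup>2 * A) + c\<^sub>Z * (\<alpha>\<^sup>2 * B)) / n) + (A\<^sup>2 * SX + B\<^sup>2 * SZ)"
      by (simp add: algebra_simps add_divide_distrib)
    \<comment> \<open>Multiplying out the three pairings of the split vectors gives
      \<open>3 * (t1 * t2 * t3 * t4)\<close>, the mixed terms \<open>q'\<close> and the transverse
      terms \<open>q\<close>.\<close>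
    also have "\<dots> = Q * (3 * (t1 * t2 * t3 * t4) + q' + q)"
      unfolding S cross moment4 Q_def[symmetric] by (simp add: algebra_simps)
    also have "\<dots> = N * pairings a b c d"
      unfolding pairings_def a inner_split Q_def q_def q'_def card_m
      by (simp add: algebra_simps add_divide_distrib)
    finally show ?thesis .
  qed
  have "spherical_design 4 (points X Z)"
    unfolding spherical_design_4_iff_moments[OF finite sphere] moments3_def
    using m1 m2 m3 m4 by (simp add: card card_m)
  then show ?thesis
    unfolding tight_spherical_4_design_def card card_m by (simp add: N_def algebra_simps)
qed

end

section \<open>Cutting a tight design into layers\<close>

context derived_designs
begin

lemma derived_designs_of_tight_design:
  assumes Y: "tight_spherical_4_design Y" and y0Y: "y0 \<in> Y"
  obtains X Z where "Y = points X Z" "finite X" "finite Z" "X \<subseteq> sphere 0 1" "Z \<subseteq> sphere 0 1"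
    "real (card X) = c\<^sub>X" "real (card Z) = c\<^sub>Z" "moments3 X" "moments3 Z"
    "\<And>a b c d. (\<Sum>x\<in>X. (a \<bullet> x) * ((b \<bullet> x) * ((c \<bullet> x) * (d \<bullet> x))))
        + v * (\<Sum>x\<in>Z. (a \<bullet> x) * ((b \<bullet> x) * ((c \<bullet> x) * (d \<bullet> x)))) = (c\<^sub>X + v * c\<^sub>Z) * pairings a b c d"
proof -
  define X where "X = {x. lift \<beta> x \<in> Y}"
  define Z where "Z = {x. lift \<alpha> x \<in> Y}"
  have D: "spherical_design 4 Y" and cY: "real (card Y) = N"
    using Y by (simp_all add: tight_spherical_4_design_def card_m N_def algebra_simps)
  then have fin: "finite Y" "Y \<noteq> {}" "Y \<subseteq> sphere 0 1"
    by (auto simp: spherical_design_def)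
  have "y \<in> points X Z" if y: "y \<in> Y" for y
  proof (cases "y = y0")
    case False
    then have "y0 \<bullet> y = \<alpha> \<or> y0 \<bullet> y = \<beta>"
      using tight_inner_products[OF card_m Y y0Y y] by blast
    then show ?thesis
      using lift_onto[of \<alpha> y] lift_onto[of \<beta> y] one_minus_pos y by (auto simp: points_def X_def Z_def)
  qed (simp add: points_def)
  then have YP: "Y = points X Z"
    using y0Y by (auto simp: points_def X_def Z_def)
  have i: "inj_on (lift \<beta>) X" "inj_on (lift \<alpha>) Z"
    using inj_lift one_minus_pos by (meson inj_on_subset subset_UNIV)+
  have finXZ: "finite X" "finite Z"
  proof -
    have "lift \<beta> ` X \<subseteq> Y" "lift \<alpha> ` Z \<subseteq> Y" by (auto simp: X_def Z_def)
    then show "finite X" "finite Z" using finite_imageD i finite_subset fin(1) by blast+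
  qed
  have sub: "X \<subseteq> sphere 0 1" "Z \<subseteq> sphere 0 1"
    using fin(3) norm_lift one_minus_pos by (auto simp: X_def Z_def)
  define A where "A = 1 - \<beta>\<^sup>2"
  define B where "B = 1 - \<alpha>\<^sup>2"
  have AB: "A > 0" "B > 0" using one_minus_pos by (simp_all add: A_def B_def)
  note cross = cross2[folded A_def B_def] cross3[folded A_def B_def] pure4[folded A_def B_def]
  have M: "(\<Sum>y\<in>Y. a \<bullet> y) = 0" "(\<Sum>y\<in>Y. (a \<bullet> y) * (b \<bullet> y)) = N / (n + 1) * (a \<bullet> b)"
      "(\<Sum>y\<in>Y. (a \<bullet> y) * ((b \<bullet> y) * (c \<bullet> y))) = 0"
      "(\<Sum>y\<in>Y. (a \<bullet> y) * ((b \<bullet> y) * ((c \<bullet> y) * (d \<bullet> y)))) = N * pairings a b c d" for a b c d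
    using D unfolding spherical_design_4_iff_moments[OF fin] moments3_def by (simp_all add: cY card_m)
  have Ey0: "E a \<bullet> y0 = 0" for a using y0_E[of a] by (simp add: inner_commute)
  note expand = YP sum_points[OF finXZ] E_lift y0_lift Ey0 y0_y0 A_def[symmetric] B_def[symmetric]
  have c: "real (card X) = c\<^sub>X" "real (card Z) = c\<^sub>Z"
  proof -
    have "1 + real (card X) + real (card Z) = N"
      using cY card_points[OF finXZ] YP by simp
    then have 1: "(real (card X) - c\<^sub>X) + (real (card Z) - c\<^sub>Z) = 0"
      using card_sum by simp
    have "1 + real (card X) * \<beta> + real (card Z) * \<alpha> = 0"
      using M(1)[of y0] unfolding expand by simp
    then have 2: "\<beta> * (real (card X) - c\<^sub>X) + \<alpha> * (real (card Z) - c\<^sub>Z) = 0"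
      using moment1 by (simp add: algebra_simps)
    show "real (card X) = c\<^sub>X" "real (card Z) = c\<^sub>Z"
      using two_by_two_zero[OF 1 2 \<alpha>_neq_\<beta>] by simp_all
  qed
  have m1: "(\<Sum>x\<in>X. a \<bullet> x) = 0" "(\<Sum>x\<in>Z. a \<bullet> x) = 0" for a
  proof -
    have 1: "sqrt A * (\<Sum>x\<in>X. a \<bullet> x) + sqrt B * (\<Sum>x\<in>Z. a \<bullet> x) = 0"
      using M(1)[of "E a"] unfolding expand by (simp add: sum_distrib_left)
    have 2: "\<beta> * (sqrt A * (\<Sum>x\<in>X. a \<bullet> x)) + \<alpha> * (sqrt B * (\<Sum>x\<in>Z. a \<bullet> x)) = 0"
      using M(2)[of y0 "E a"] unfolding expand y0_E by (simp add: sum_distrib_left mult_ac)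
    show "(\<Sum>x\<in>X. a \<bullet> x) = 0" "(\<Sum>x\<in>Z. a \<bullet> x) = 0"
      using two_by_two_zero[OF 1 2 \<alpha>_neq_\<beta>] AB by simp_all
  qed
  have m2: "(\<Sum>x\<in>X. (a \<bullet> x) * (b \<bullet> x)) = c\<^sub>X / n * (a \<bullet> b)" "(\<Sum>x\<in>Z. (a \<bullet> x) * (b \<bullet> x)) = c\<^sub>Z / n * (a \<bullet> b)" for a b
  proof -
    define SX where "SX = (\<Sum>x\<in>X. (a \<bullet> x) * (b \<bullet> x))"
    define SZ where "SZ = (\<Sum>x\<in>Z. (a \<bullet> x) * (b \<bullet> x))"
    have pull: "(\<Sum>x\<in>S. (s * (a \<bullet> x)) * (s * (b \<bullet> x))) = s\<^sup>2 * (\<Sum>x\<in>S. (a \<bullet> x) * (b \<bullet> x))"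
      "(\<Sum>x\<in>S. p * ((s * (a \<bullet> x)) * (s * (b \<bullet> x)))) = p * (s\<^sup>2 * (\<Sum>x\<in>S. (a \<bullet> x) * (b \<bullet> x)))" for S s p
      by (simp_all add: sum_distrib_left power2_eq_square mult_ac)
    \<comment> \<open>The expected values \<open>c\<^sub>X / n * (a \<bullet> b)\<close> and
      \<open>c\<^sub>Z / n * (a \<bullet> b)\<close> satisfy the same two equations by
      \<open>cross2\<close> and \<open>cross3\<close>, so \<open>two_by_two_zero\<close> applies to
      the differences.\<close>
    have "A * SX + B * SZ = N / (n + 1) * (a \<bullet> b)"
      using M(2)[of "E a" "E b"] AB unfolding expand E_inner pull SX_def SZ_def by simp
    also have "\<dots> = (c\<^sub>X * A + c\<^sub>Z * B) / n * (a \<bullet> b)"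
      by (simp only: cross)
    finally have 1: "A * (SX - c\<^sub>X / n * (a \<bullet> b)) + B * (SZ - c\<^sub>Z / n * (a \<bullet> b)) = 0"
      by (simp add: algebra_simps add_divide_distrib)
    have "\<beta> * (A * SX) + \<alpha> * (B * SZ) = 0"
      using M(3)[of y0 "E a" "E b"] AB unfolding expand pull SX_def SZ_def by simp
    also have "0 = (c\<^sub>X * (\<beta> * A) + c\<^sub>Z * (\<alpha> * B)) / n * (a \<bullet> b)"
      by (simp only: cross)
    finally have 2: "\<beta> * (A * (SX - c\<^sub>X / n * (a \<bullet> b))) + \<alpha> * (B * (SZ - c\<^sub>Z / n * (a \<bullet> b))) = 0"
      by (simp add: algebra_simps add_divide_distrib)
    show "(\<Sum>x\<in>X. (a \<bullet> x) * (b \<bullet> x)) = c\<^sub>X / n * (a \<bullet> b)" "(\<Sum>x\<in>Z. (a \<bullet> x) * (b \<bullet> x)) = c\<^sub>Z / n * (a \<bullet> b)"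
      using two_by_two_zero[OF 1 2 \<alpha>_neq_\<beta>] AB by (simp_all add: SX_def SZ_def)
  qed
  have m3: "(\<Sum>x\<in>X. (a \<bullet> x) * ((b \<bullet> x) * (c \<bullet> x))) = 0" "(\<Sum>x\<in>Z. (a \<bullet> x) * ((b \<bullet> x) * (c \<bullet> x))) = 0" for a b c
  proof -
    have pull: "(\<Sum>x\<in>S. (s * (a \<bullet> x)) * ((s * (b \<bullet> x)) * (s * (c \<bullet> x)))) = s ^ 3 * (\<Sum>x\<in>S. (a \<bullet> x) * ((b \<bullet> x) * (c \<bullet> x)))"
      "(\<Sum>x\<in>S. p * ((s * (a \<bullet> x)) * ((s * (b \<bullet> x)) * (s * (c \<bullet> x))))) = p * (s ^ 3 * (\<Sum>x\<in>S. (a \<bullet> x) * ((b \<bullet> x) * (c \<bullet> x))))" for S s p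
      by (simp_all add: sum_distrib_left power3_eq_cube mult_ac)
    have 1: "sqrt A ^ 3 * (\<Sum>x\<in>X. (a \<bullet> x) * ((b \<bullet> x) * (c \<bullet> x))) + sqrt B ^ 3 * (\<Sum>x\<in>Z. (a \<bullet> x) * ((b \<bullet> x) * (c \<bullet> x))) = 0"
      using M(3)[of "E a" "E b" "E c"] unfolding expand pull by simp
    have 2: "\<beta> * (sqrt A ^ 3 * (\<Sum>x\<in>X. (a \<bullet> x) * ((b \<bullet> x) * (c \<bullet> x)))) + \<alpha> * (sqrt B ^ 3 * (\<Sum>x\<in>Z. (a \<bullet> x) * ((b \<bullet> x) * (c \<bullet> x)))) = 0"
      using M(4)[of y0 "E a" "E b" "E c"] unfolding expand pull pairings_def y0_E by simp
    show "(\<Sum>x\<in>X. (a \<bullet> x) * ((b \<bullet> x) * (c \<bullet> x))) = 0" "(\<Sum>x\<in>Z. (a \<bullet> x) * ((b \<bullet> x) * (c \<bullet> x))) = 0"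
      using two_by_two_zero[OF 1 2 \<alpha>_neq_\<beta>] AB by simp_all
  qed
  have m4: "(\<Sum>x\<in>X. (a \<bullet> x) * ((b \<bullet> x) * ((c \<bullet> x) * (d \<bullet> x))))
        + v * (\<Sum>x\<in>Z. (a \<bullet> x) * ((b \<bullet> x) * ((c \<bullet> x) * (d \<bullet> x)))) = (c\<^sub>X + v * c\<^sub>Z) * pairings a b c d"
    (is "?SX + v * ?SZ = _") for a b c d
  proof -
    have vA: "A\<^sup>2 * v = B\<^sup>2" using AB v_eq by (simp add: A_def B_def)
    have pull: "(\<Sum>x\<in>S. (s * (a \<bullet> x)) * ((s * (b \<bullet> x)) * ((s * (c \<bullet> x)) * (s * (d \<bullet> x)))))
      = s ^ 4 * (\<Sum>x\<in>S. (a \<bullet> x) * ((b \<bullet> x) * ((c \<bullet> x) * (d \<bullet> x))))" for S s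
      by (simp_all add: sum_distrib_left power4_eq_xxxx mult_ac)
    have s4: "sqrt A ^ 4 = A\<^sup>2" "sqrt B ^ 4 = B\<^sup>2"
      using AB by (simp_all add: power4_eq_xxxx power2_eq_square)
    let ?q = "(a \<bullet> b) * (c \<bullet> d) + (a \<bullet> c) * (b \<bullet> d) + (a \<bullet> d) * (b \<bullet> c)"
    have "A\<^sup>2 * (?SX + v * ?SZ) = A\<^sup>2 * ?SX + B\<^sup>2 * ?SZ"
      by (simp add: algebra_simps flip: vA)
    also have "\<dots> = N * pairings (E a) (E b) (E c) (E d)"
      using M(4)[of "E a" "E b" "E c" "E d"] unfolding expand pull s4 by simp
    also have "\<dots> = N / ((n + 1) * (n + 3)) * ?q"
      by (simp add: pairings_def E_inner card_m add_ac)
    also have "\<dots> = (A\<^sup>2 * c\<^sub>X + B\<^sup>2 * c\<^sub>Z) / (n * (n + 2)) * ?q"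
      by (simp only: cross)
    also have "\<dots> = (A\<^sup>2 * c\<^sub>X + B\<^sup>2 * c\<^sub>Z) * pairings a b c d"
      by (simp add: pairings_def card_n)
    also have "\<dots> = A\<^sup>2 * ((c\<^sub>X + v * c\<^sub>Z) * pairings a b c d)"
      by (simp add: algebra_simps flip: vA)
    finally show ?thesis using AB by simp
  qed
  show thesis
    by (rule that[OF YP finXZ sub c _ _ m4]) (simp_all add: moments3_def m1 m2 m3 c card_n)
qed

end

text \<open>Both values occur because the inner products with a fixed \<open>x\<close> sum to 0,
  including the term 1 from \<open>x\<close> itself: \<open>A\<close> alone would make the sum
  positive, and \<open>B\<close> alone is excluded by its count. \<open>A = 0\<close> is allowed, as
  happens for \<open>k = 2\<close>.\<close>

lemma inner_products_eq_pair:
  fixes X :: "(real^'n) set"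
  assumes fin: "finite X" "X \<noteq> {}" "X \<subseteq> sphere 0 1" and sum0: "\<And>a. (\<Sum>x\<in>X. a \<bullet> x) = 0"
    and two: "\<And>x y. x \<in> X \<Longrightarrow> y \<in> X \<Longrightarrow> x \<noteq> y \<Longrightarrow> x \<bullet> y = A \<or> x \<bullet> y = B"
    and A: "A \<ge> 0" and B: "1 + (real (card X) - 1) * B \<noteq> 0"
  shows "inner_products 1 1 X X = {A, B}"
proof -
  obtain x where x: "x \<in> X" using fin by blast
  have xx: "x \<bullet> x = 1" using fin x by (auto simp: norm_eq_1)
  have sum: "1 + (\<Sum>y\<in>X - {x}. x \<bullet> y) = 0"
    using sum0[of x] sum.remove[OF fin(1) x, of "\<lambda>y. x \<bullet> y"] xx by simp
  have "\<exists>y\<in>X - {x}. x \<bullet> y = B"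
  proof (rule ccontr)
    assume "\<not> ?thesis"
    then have "(\<Sum>y\<in>X - {x}. x \<bullet> y) \<ge> 0"
      using two[OF x] A by (intro sum_nonneg) force
    then show False using sum by simp
  qed
  moreover have "\<exists>y\<in>X - {x}. x \<bullet> y = A"
  proof (rule ccontr)
    assume "\<not> ?thesis"
    then have "(\<Sum>y\<in>X - {x}. x \<bullet> y) = (\<Sum>y\<in>X - {x}. B)"
      using two[OF x] by (intro sum.cong) force+
    moreover have "real (card (X - {x})) = real (card X) - 1"
      using fin(1) x card_gt_0_iff[of X] by (auto simp: of_nat_diff)
    ultimately show False using sum B by simp
  qed
  ultimately show ?thesis
    using two x unfolding inner_products_def by fastforce
qed

lemma inner_products_scaleR:
  assumes "r > 0"
  shows "inner_products r r ((*\<^sub>R) r ` Z) ((*\<^sub>R) r ` Z) = inner_products 1 1 Z Z"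
proof -
  have "inner_products r r ((*\<^sub>R) r ` Z) ((*\<^sub>R) r ` Z)
      = {((r *\<^sub>R x) \<bullet> (r *\<^sub>R y)) / (r * r) | x y. x \<in> Z \<and> y \<in> Z \<and> r *\<^sub>R x \<noteq> r *\<^sub>R y}"
    unfolding inner_products_def by blast
  then show ?thesis using assms by (simp add: inner_products_def)
qed

section \<open>The two directions of the equivalence\<close>

context derived_designs
begin

lemma euclidean_design_of_tight_design:
  assumes Y: "tight_spherical_4_design Y" and y0Y: "y0 \<in> Y" and r: "r > 0" "r \<noteq> 1"
  shows "\<exists>(X :: (real^'n) set) Z' w. euclidean_design_two_spheres 4 1 r X Z' w \<and>
    real (card X) = c\<^sub>X \<and> real (card Z') = c\<^sub>Z \<and>
    inner_products 1 1 X X = {(K - 2) / (K * (2 * K - 3)), - (1 / (2 * K - 3))} \<and>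
    inner_products r r Z' Z' = {1 / (2 * K + 1), - ((K + 1) / (L * (2 * K + 1)))} \<and>
    inner_products 1 r X Z' = {1 / sqrt n, - (1 / sqrt n)} \<and>
    (\<forall>x\<in>X. w x = 1) \<and> (\<forall>x\<in>Z'. w x = v / r ^ 4)"
proof -
  obtain X Z where YP: "Y = points X Z" and fin: "finite X" "finite Z" and sub: "X \<subseteq> sphere 0 1" "Z \<subseteq> sphere 0 1"
    and c: "real (card X) = c\<^sub>X" "real (card Z) = c\<^sub>Z" and m: "moments3 X" "moments3 Z"
    and XZ: "\<And>a b c d. (\<Sum>x\<in>X. (a \<bullet> x) * ((b \<bullet> x) * ((c \<bullet> x) * (d \<bullet> x))))
        + v * (\<Sum>x\<in>Z. (a \<bullet> x) * ((b \<bullet> x) * ((c \<bullet> x) * (d \<bullet> x)))) = (c\<^sub>X + v * c\<^sub>Z) * pairings a b c d"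
    using derived_designs_of_tight_design[OF Y y0Y] by blast
  \<comment> \<open>The norm distinguishes the layers since \<open>r \<noteq> 1\<close>.\<close>
  define w where "w x = (if norm x = 1 then 1 else v / r ^ 4)" for x :: "real^'n"
  have w: "\<forall>x\<in>X. w x = 1" "\<forall>x\<in>(*\<^sub>R) r ` Z. w x = v / r ^ 4"
    using sub r by (auto simp: w_def)
  have design: "euclidean_design_two_spheres 4 1 r X ((*\<^sub>R) r ` Z) w"
    by (rule euclidean_design_of_moments[OF fin sub r v_pos w m]) (simp add: XZ c)
  have inj: "inj_on ((*\<^sub>R) r) Z" using r by (auto simp: inj_on_def)
  have L1: "L \<ge> 1" using K by (simp add: L_def)
  have pos: "c\<^sub>X > 0" "c\<^sub>Z > 0" using K L1 by (auto simp: c\<^sub>X_def c\<^sub>Z_def intro!: mult_pos_pos)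
  then have ne: "X \<noteq> {}" "Z \<noteq> {}" using c by auto
  have sum0: "(\<Sum>x\<in>X. a \<bullet> x) = 0" "(\<Sum>x\<in>Z. a \<bullet> x) = 0" for a
    using m by (simp_all add: moments3_def)
  have lift_ip: "p * q + sqrt (1 - p\<^sup>2) * sqrt (1 - q\<^sup>2) * (x \<bullet> y) = \<alpha> \<or> p * q + sqrt (1 - p\<^sup>2) * sqrt (1 - q\<^sup>2) * (x \<bullet> y) = \<beta>"
    if "lift p x \<in> Y" "lift q y \<in> Y" "lift p x \<noteq> lift q y" for p q x y
    using tight_inner_products[OF card_m Y that] by (simp add: lift_lift)
  have quot: "t = (u - p\<^sup>2) / (1 - p\<^sup>2)" if "1 - p\<^sup>2 > 0" "p * p + sqrt (1 - p\<^sup>2) * sqrt (1 - p\<^sup>2) * t = u" for p t u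
    using that by (simp add: field_simps power2_eq_square)
  have same: "x \<bullet> y = (\<alpha> - p\<^sup>2) / (1 - p\<^sup>2) \<or> x \<bullet> y = (\<beta> - p\<^sup>2) / (1 - p\<^sup>2)"
    if p: "1 - p\<^sup>2 > 0" and "lift p x \<in> Y" "lift p y \<in> Y" "x \<noteq> y" for p x y
  proof -
    have "lift p x \<noteq> lift p y" using inj_lift[OF p] that by (auto dest: injD)
    then show ?thesis using lift_ip[of p x p y] quot[OF p] that by blast
  qed
  have ipX: "inner_products 1 1 X X = {(K - 2) / (K * (2 * K - 3)), - (1 / (2 * K - 3))}"
  proof (rule inner_products_eq_pair[OF fin(1) ne(1) sub(1) sum0(1)])
    show "x \<bullet> y = (K - 2) / (K * (2 * K - 3)) \<or> x \<bullet> y = - (1 / (2 * K - 3))"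
      if "x \<in> X" "y \<in> X" "x \<noteq> y" for x y
      using same[OF one_minus_pos(2), of x y] that unfolding quotients by (auto simp: YP points_def)
    show "(K - 2) / (K * (2 * K - 3)) \<ge> 0" using K by simp
    \<comment> \<open>The sum that would arise from the negative value alone has a closed form with
      the factor \<open>(2 * K + 1) * L\<^sup>2 - 1\<close>; the bound keeps it away from 0. The
      argument for \<open>Z\<close> is analogous.\<close>
    have "(2 * K + 1) * L\<^sup>2 \<ge> 5 * 1" using K L1 by (intro mult_mono) auto
    then have "L * (2 * ((2 * K + 1) * L\<^sup>2 - 1)) \<noteq> 0" using L1 by auto
    moreover have "1 + (real (card X) - 1) * - (1 / (2 * K - 3)) = - (L * (2 * ((2 * K + 1) * L\<^sup>2 - 1))) / (2 * K - 3)"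
      using nz unfolding c c\<^sub>X_def by (simp add: divide_simps) (simp add: L_def power2_eq_square power3_eq_cube algebra_simps)
    ultimately show "1 + (real (card X) - 1) * - (1 / (2 * K - 3)) \<noteq> 0"
      using nz by simp
  qed
  have ipZ: "inner_products 1 1 Z Z = {1 / (2 * K + 1), - ((K + 1) / (L * (2 * K + 1)))}"
  proof (rule inner_products_eq_pair[OF fin(2) ne(2) sub(2) sum0(2)])
    show "x \<bullet> y = 1 / (2 * K + 1) \<or> x \<bullet> y = - ((K + 1) / (L * (2 * K + 1)))"
      if "x \<in> Z" "y \<in> Z" "x \<noteq> y" for x y
      using same[OF one_minus_pos(1), of x y] that unfolding quotients by (auto simp: YP points_def)
    show "1 / (2 * K + 1) \<ge> 0" using K by simp
    have "K * (2 * K - 3) * (K + 1) \<ge> 2 * 1 * 3" using K by (intro mult_mono) auto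
    then have "2 * K\<^sup>2 * (K * (2 * K - 3) * (K + 1) - 1) \<noteq> 0" using nz by auto
    moreover have "1 + (real (card Z) - 1) * - ((K + 1) / (L * (2 * K + 1)))
        = - (2 * K\<^sup>2 * (K * (2 * K - 3) * (K + 1) - 1)) / (L * (2 * K + 1))"
      using nz unfolding c c\<^sub>Z_def by (simp add: divide_simps) (simp add: L_def power2_eq_square power3_eq_cube algebra_simps)
    ultimately show "1 + (real (card Z) - 1) * - ((K + 1) / (L * (2 * K + 1))) \<noteq> 0"
      using nz by simp
  qed
  have mixed: "x \<bullet> z = 1 / sqrt n \<or> x \<bullet> z = - (1 / sqrt n)" if xz: "x \<in> X" "z \<in> Z" for x z
  proof -
    have "y0 \<bullet> lift \<beta> x \<noteq> y0 \<bullet> lift \<alpha> z" using \<alpha>_neq_\<beta> by (simp add: y0_lift)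
    then have "\<beta> * \<alpha> + sqrt (1 - \<beta>\<^sup>2) * sqrt (1 - \<alpha>\<^sup>2) * (x \<bullet> z) = \<alpha> \<or> \<beta> * \<alpha> + sqrt (1 - \<beta>\<^sup>2) * sqrt (1 - \<alpha>\<^sup>2) * (x \<bullet> z) = \<beta>"
      using xz by (intro lift_ip) (auto simp: YP points_def)
    moreover have "sqrt (1 - \<beta>\<^sup>2) * sqrt (1 - \<alpha>\<^sup>2) \<noteq> 0" using one_minus_pos by simp
    moreover have "t = (u - p) / s" if "s \<noteq> 0" "p + s * t = u" for p s t u :: real
      using that by (simp add: field_simps)
    ultimately have "x \<bullet> z = (\<alpha> - \<beta> * \<alpha>) / (sqrt (1 - \<beta>\<^sup>2) * sqrt (1 - \<alpha>\<^sup>2))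
        \<or> x \<bullet> z = (\<beta> - \<beta> * \<alpha>) / (sqrt (1 - \<beta>\<^sup>2) * sqrt (1 - \<alpha>\<^sup>2))"
      by blast
    then show ?thesis unfolding mixed_quotients .
  qed
  have sn: "1 / sqrt n > 0" using n_ge by simp
  obtain x where x: "x \<in> X" using ne by blast
  \<comment> \<open>Both signs occur already for this one \<open>x\<close>, since its inner products
    with \<open>Z\<close> sum to 0.\<close>
  have "\<exists>z\<in>Z. x \<bullet> z = 1 / sqrt n"
  proof (rule ccontr)
    assume "\<not> ?thesis"
    then have "x \<bullet> z < 0" if "z \<in> Z" for z using mixed[OF x that] sn that by force
    then have "(\<Sum>z\<in>Z. - (x \<bullet> z)) > 0" using ne fin by (intro sum_pos) simp_all
    then show False using sum0 by (simp add: sum_negf)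
  qed
  moreover have "\<exists>z\<in>Z. x \<bullet> z = - (1 / sqrt n)"
  proof (rule ccontr)
    assume "\<not> ?thesis"
    then have "x \<bullet> z > 0" if "z \<in> Z" for z using mixed[OF x that] sn that by force
    then have "(\<Sum>z\<in>Z. x \<bullet> z) > 0" using ne fin by (intro sum_pos)
    then show False using sum0 by simp
  qed
  moreover have "inner_products 1 r X ((*\<^sub>R) r ` Z) = {x \<bullet> z | x z. x \<in> X \<and> z \<in> Z}"
  proof -
    have "x \<noteq> r *\<^sub>R z" if "x \<in> X" "z \<in> Z" for x z
    proof -
      have "norm x = 1" "norm (r *\<^sub>R z) = r" using that sub r by auto
      then show ?thesis using r by auto
    qed
    then have "inner_products 1 r X ((*\<^sub>R) r ` Z) = {(x \<bullet> (r *\<^sub>R z)) / (1 * r) | x z. x \<in> X \<and> z \<in> Z}"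
      unfolding inner_products_def by blast
    then show ?thesis using r by simp
  qed
  ultimately have ipXZ: "inner_products 1 r X ((*\<^sub>R) r ` Z) = {1 / sqrt n, - (1 / sqrt n)}"
    using mixed x by fastforce
  have "real (card ((*\<^sub>R) r ` Z)) = c\<^sub>Z"
    by (simp add: card_image[OF inj] c)
  moreover have "inner_products r r ((*\<^sub>R) r ` Z) ((*\<^sub>R) r ` Z) = {1 / (2 * K + 1), - ((K + 1) / (L * (2 * K + 1)))}"
    by (simp only: inner_products_scaleR[OF r(1)] ipZ)
  ultimately show ?thesis
    using design c(1) ipX ipXZ w by blast
qed

lemma tight_design_of_euclidean_design:
  fixes X Z' :: "(real^'n) set"
  assumes D: "euclidean_design_two_spheres 4 1 r X Z' w"
    and c: "real (card X) = c\<^sub>X" "real (card Z') = c\<^sub>Z"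
    and ip: "inner_products 1 r X Z' = {1 / sqrt n, - (1 / sqrt n)}"
    and w: "\<forall>x\<in>X. w x = 1" "\<forall>x\<in>Z'. w x = v / r ^ 4"
  shows "\<exists>Y :: (real^'m) set. tight_spherical_4_design Y"
proof -
  have r: "r > 0" "r \<noteq> 1" and finX: "finite X" and sX: "X \<subseteq> sphere 0 1" and finZ': "finite Z'" "Z' \<subseteq> sphere 0 r"
    using D by (auto simp: euclidean_design_two_spheres_def)
  define Z where "Z = (*\<^sub>R) (1 / r) ` Z'"
  have Z': "Z' = (*\<^sub>R) r ` Z" using r by (simp add: Z_def image_image)
  have finZ: "finite Z" using finZ' by (simp add: Z_def)
  have sZ: "Z \<subseteq> sphere 0 1" using finZ' r by (auto simp: Z_def)
  have "inj_on ((*\<^sub>R) r) Z" using r by (auto simp: inj_on_def)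
  then have cZ: "real (card Z) = c\<^sub>Z" using c by (simp add: Z' card_image)
  note M = moments_of_euclidean_design[OF finX finZ sX sZ r v_pos w[unfolded Z'] D[unfolded Z']]
  have sq: "(x \<bullet> z)\<^sup>2 = 1 / n" if "x \<in> X" "z \<in> Z" for x z
  proof -
    have "norm x = 1" "norm (r *\<^sub>R z) = r" using that sX sZ r by auto
    then have "x \<noteq> r *\<^sub>R z" using r by auto
    then have "(x \<bullet> (r *\<^sub>R z)) / (1 * r) \<in> inner_products 1 r X Z'"
      using that unfolding inner_products_def Z' by blast
    then show ?thesis using r n_ge unfolding ip by (auto simp: power_divide)
  qed
  have "(\<Sum>y\<in>X. (x \<bullet> y) ^ 3) = 0" if x: "x \<in> X" for x
  proof -
    \<comment> \<open>On the cross inner products, cubing is multiplication by \<open>1 / n\<close>,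
      which reduces the cubic moment to the vanishing linear one.\<close>
    have "(\<Sum>z\<in>Z. (x \<bullet> z) * ((x \<bullet> z) * (x \<bullet> z))) = (\<Sum>z\<in>Z. (x \<bullet> z) * (1 / n))"
      by (rule sum.cong) (simp_all add: sq[OF x] flip: power2_eq_square)
    also have "\<dots> = 0" unfolding sum_distrib_right[symmetric] M(2) by simp
    finally show ?thesis using M(5)[of x x x] by (simp add: power3_eq_cube mult.assoc)
  qed
  then have X3: "(\<Sum>x\<in>X. (a \<bullet> x) * ((b \<bullet> x) * (c \<bullet> x))) = 0" for a b c
    by (intro cubic_moments_zero) simp
  then have Z3: "(\<Sum>x\<in>Z. (a \<bullet> x) * ((b \<bullet> x) * (c \<bullet> x))) = 0" for a b c
    using M(5)[of a b c] v_pos r by simp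
  have "tight_spherical_4_design (points X Z)"
    by (rule tight_design_points[OF finX finZ sX sZ c(1) cZ])
      (simp_all add: moments3_def M(1-4) X3 Z3 M(6)[unfolded c(1) cZ])
  then show ?thesis by blast
qed

end

theorem theorem1p7:
  fixes k :: int
  assumes k: "k \<ge> 2"
    and n: "int CARD('n::finite) = (2 * k - 1)^2 - 4"
    and m: "CARD('m::finite) = CARD('n) + 1"
  shows "(\<exists>r2 (X1 :: (real^'n) set) (X2 :: (real^'n) set) (w :: real^'n \<Rightarrow> real).
            euclidean_design_two_spheres 4 1 r2 X1 X2 w \<and>
            int (card X1) = 2 * (2 * k + 1) * (k - 1)^3 \<and>
            int (card X2) = 2 * k^3 * (2 * k - 3) \<and>
            inner_products 1 1 X1 X1 =
              {(of_int k - 2) / (of_int k * (2 * of_int k - 3)), - (1 / (2 * of_int k - 3))} \<and>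
            inner_products r2 r2 X2 X2 =
              {1 / (2 * of_int k + 1),
               - ((of_int k + 1) / ((of_int k - 1) * (2 * of_int k + 1)))} \<and>
            inner_products 1 r2 X1 X2 =
              {1 / sqrt (real CARD('n)), - (1 / sqrt (real CARD('n)))} \<and>
            (\<forall>x\<in>X1. w x = 1) \<and>
            (\<forall>x\<in>X2. w x =
               ((2 * of_int k + 1)^2 * (of_int k - 1)^4) / ((2 * of_int k - 3)^2 * of_int k ^ 4)
                 * r2 powi (-4)))
         \<longleftrightarrow> (\<exists>Y :: (real^'m) set. tight_spherical_4_design Y)"
    (is "?lhs \<longleftrightarrow> ?rhs")
proof
  interpret parameters "of_int k :: real"
    by unfold_locales (use k in simp)
  have "real_of_int (int CARD('n)) = of_int ((2 * k - 1)^2 - 4)"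
    by (simp only: n)
  then have card_n: "real CARD('n) = n"
    by (simp add: n_def)
  have card_m: "real CARD('m) = n + 1"
    using m card_n by simp
  have derived: "\<exists>E :: real^'n \<Rightarrow> real^'m. derived_designs (of_int k) y0 E" if y0: "norm y0 = 1" for y0 :: "real^'m"
  proof -
    obtain E :: "real^'n \<Rightarrow> real^'m" where E: "linear E" "\<And>x y. E x \<bullet> E y = x \<bullet> y"
      "\<And>x. y0 \<bullet> E x = 0" "\<And>z. y0 \<bullet> z = 0 \<Longrightarrow> \<exists>x. z = E x"
      using hyperplane_isometry[OF y0 m] by blast
    have "derived_designs (of_int k) y0 E"
      by (intro derived_designs.intro derived_designs_axioms.intro parameters_axioms)
        (use E y0 card_n card_m in auto)
    then show ?thesis by blast
  qed
  have c\<^sub>X: "int p = 2 * (2 * k + 1) * (k - 1)^3 \<longleftrightarrow> real p = c\<^sub>X" for p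
  proof -
    have "real p = c\<^sub>X \<longleftrightarrow> real_of_int (int p) = of_int (2 * (2 * k + 1) * (k - 1)^3)"
      by (simp add: c\<^sub>X_def L_def)
    then show ?thesis by (simp only: of_int_eq_iff)
  qed
  have c\<^sub>Z: "int p = 2 * k^3 * (2 * k - 3) \<longleftrightarrow> real p = c\<^sub>Z" for p
  proof -
    have "real p = c\<^sub>Z \<longleftrightarrow> real_of_int (int p) = of_int (2 * k^3 * (2 * k - 3))"
      by (simp add: c\<^sub>Z_def)
    then show ?thesis by (simp only: of_int_eq_iff)
  qed
  have weight: "((2 * of_int k + 1)^2 * L^4) / ((2 * of_int k - 3)^2 * of_int k ^ 4) * r powi (-4)
      = v / r ^ 4" for r :: real
    by (simp add: v_def power_int_def divide_inverse power_inverse)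
  note simps = c\<^sub>X c\<^sub>Z weight card_n L_def[symmetric]
  {
    assume ?lhs
    then obtain r w and X Z :: "(real^'n) set" where D: "euclidean_design_two_spheres 4 1 r X Z w"
      "real (card X) = c\<^sub>X" "real (card Z) = c\<^sub>Z"
      "inner_products 1 r X Z = {1 / sqrt n, - (1 / sqrt n)}"
      "\<forall>x\<in>X. w x = 1" "\<forall>x\<in>Z. w x = v / r ^ 4"
      unfolding simps by blast
    \<comment> \<open>Any unit vector can serve as the pole over which the layers are stacked; in
      the other direction it has to be a point of \<open>Y\<close>.\<close>
    obtain y0 :: "real^'m" where "norm y0 = 1" using norm_axis_1 by blast
    then obtain E :: "real^'n \<Rightarrow> real^'m" where "derived_designs (of_int k) y0 E"
      using derived by blast
    from derived_designs.tight_design_of_euclidean_design[OF this D] show ?rhs .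
  next
    assume ?rhs
    then obtain Y :: "(real^'m) set" where Y: "tight_spherical_4_design Y" by blast
    then obtain y0 where y0: "y0 \<in> Y" "norm y0 = 1"
      by (fastforce simp: tight_spherical_4_design_def spherical_design_def)
    then obtain E :: "real^'n \<Rightarrow> real^'m" where "derived_designs (of_int k) y0 E"
      using derived by blast
    \<comment> \<open>The radius 2 is an arbitrary choice of a positive number other than 1.\<close>
    then show ?lhs
      unfolding simps
      by (intro exI[of _ 2] derived_designs.euclidean_design_of_tight_design[OF _ Y y0(1)]) simp_all
  }
qed

end
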